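(* Let $\mathscr{H}$ be a Hilbert space, $X\in\mathbb{B}(\mathscr{H})$, $r\ge 1$, and let $f,g$ be nonnegative continuous functions on $[0,\infty)$ satisfying $f(t)g(t)=t$ for all $t\in[0,\infty)$. Then $$\omega^{r}(X)\leq 2^{r-2}\left\|f^{2r}(|X|)+g^{2r}(|X^*|)\right\|$$ and $$\omega^{r}(X)\leq 2^{r-2}\left\|f^{2r}(|X|)+f^{2r}(|X^*|)\right\|^{\frac12}\left\|g^{2r}(|X|)+g^{2r}(|X^*|)\right\|^{\frac12}.$$
   Context: Hilbert spaces are complex. $\mathbb{B}(\mathscr{H})$ is the algebra of bounded linear operators on $\mathscr{H}$. The numerical radius is $\omega(X)=\sup\{|\langle Xx,x\rangle| : x\in\mathscr{H},\ \|x\|=1\}$, and $\omega^{r}(X)=(\omega(X))^r$. $|A|=(A^*A)^{1/2}$. $f^{2r}(A)$ denotes $h(A)$, with $h(t)=f(t)^{2r}$, in the continuous functional calculus of the positive operator $A$ (similarly $g^{2r}$). $\|\cdot\|$ is the operator norm. *)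

theory Defs
  imports
    "HOL-Analysis.Analysis"
    "HOL-Computational_Algebra.Polynomial"
begin

text \<open>
  Complex Hilbert spaces as a type class. The real scalar multiplication, the norm and
  completeness come from the library class of real Banach spaces; the axioms below say that
  they are the ones induced by the complex structure. The inner product is linear in its first
  argument. Positive definiteness of the inner product follows from the last axiom. The zero
  space is not excluded.
\<close>

class chilbert_space = banach +
  fixes scaleC :: "complex \<Rightarrow> 'a \<Rightarrow> 'a"  (infixr \<open>*\<^sub>C\<close> 75)
    and cinner :: "'a \<Rightarrow> 'a \<Rightarrow> complex"
  assumes scaleC_add_right: "c *\<^sub>C (x + y) = c *\<^sub>C x + c *\<^sub>C y"
    and scaleC_add_left: "(c + d) *\<^sub>C x = c *\<^sub>C x + d *\<^sub>C x"
    and scaleC_scaleC: "c *\<^sub>C (d *\<^sub>C x) = (c * d) *\<^sub>C x"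
    and scaleC_one: "1 *\<^sub>C x = x"
    and scaleR_scaleC: "a *\<^sub>R x = complex_of_real a *\<^sub>C x"
    and cinner_commute: "cinner x y = cnj (cinner y x)"
    and cinner_add_left: "cinner (x + y) z = cinner x z + cinner y z"
    and cinner_scaleC_left: "cinner (c *\<^sub>C x) y = c * cinner x y"
    and norm_eq_sqrt_cinner: "norm x = sqrt (Re (cinner x x))"

text \<open>
  The algebra of bounded (complex-linear) operators, as a subset of the bounded real-linear
  maps. The library norm on the latter restricts to the operator norm.
\<close>

definition bounded_ops :: "('a::chilbert_space \<Rightarrow>\<^sub>L 'a) set"
  where "bounded_ops = {A. \<forall>c x. blinfun_apply A (c *\<^sub>C x) = c *\<^sub>C blinfun_apply A x}"

definition adj :: "('a::chilbert_space \<Rightarrow>\<^sub>L 'a) \<Rightarrow> 'a \<Rightarrow>\<^sub>L 'a"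
  where "adj A = (THE B. B \<in> bounded_ops \<and>
    (\<forall>x y. cinner (blinfun_apply A x) y = cinner x (blinfun_apply B y)))"

definition positive_op :: "('a::chilbert_space \<Rightarrow>\<^sub>L 'a) \<Rightarrow> bool"
  where "positive_op A \<longleftrightarrow> A \<in> bounded_ops \<and>
    (\<forall>x. cinner (blinfun_apply A x) x \<in> \<real> \<and> 0 \<le> Re (cinner (blinfun_apply A x) x))"

definition sqrt_op :: "('a::chilbert_space \<Rightarrow>\<^sub>L 'a) \<Rightarrow> 'a \<Rightarrow>\<^sub>L 'a"
  where "sqrt_op A = (THE B. positive_op B \<and> B o\<^sub>L B = A)"

definition abs_op :: "('a::chilbert_space \<Rightarrow>\<^sub>L 'a) \<Rightarrow> 'a \<Rightarrow>\<^sub>L 'a"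
  where "abs_op A = sqrt_op (adj A o\<^sub>L A)"

text \<open>The inserted 0 only matters on the zero space, where there are no unit vectors.\<close>

definition numerical_radius :: "('a::chilbert_space \<Rightarrow>\<^sub>L 'a) \<Rightarrow> real"
  where "numerical_radius A =
    Sup (insert 0 {cmod (cinner (blinfun_apply A x) x) | x. norm x = 1})"

definition spectrum_op :: "('a::chilbert_space \<Rightarrow>\<^sub>L 'a) \<Rightarrow> complex set"
  where "spectrum_op A = {z. \<not> (\<exists>B \<in> bounded_ops. \<forall>x.
    blinfun_apply B (blinfun_apply A x - z *\<^sub>C x) = x \<and>
    blinfun_apply A (blinfun_apply B x) - z *\<^sub>C blinfun_apply B x = x)}"

definition poly_op :: "real poly \<Rightarrow> ('a::chilbert_space \<Rightarrow>\<^sub>L 'a) \<Rightarrow> 'a \<Rightarrow>\<^sub>L 'a"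
  where "poly_op p A = (\<Sum>i\<le>degree p. coeff p i *\<^sub>R (((o\<^sub>L) A ^^ i) id_blinfun))"

text \<open>
  Continuous functional calculus for a self-adjoint operator and a real function that is
  continuous on the spectrum: the norm limit of \<open>p\<^sub>n(A)\<close>, where the real polynomials
  \<open>p\<^sub>n\<close> converge to \<open>h\<close> uniformly on the spectrum (which is real). Such polynomials exist by
  the Weierstrass theorem, and the limit does not depend on their choice.
\<close>

definition cfc :: "('a::chilbert_space \<Rightarrow>\<^sub>L 'a) \<Rightarrow> (real \<Rightarrow> real) \<Rightarrow> 'a \<Rightarrow>\<^sub>L 'a"
  where "cfc A h = (THE B. \<exists>p :: nat \<Rightarrow> real poly.
    uniform_limit {t. complex_of_real t \<in> spectrum_op A} (\<lambda>n. poly (p n)) h sequentially \<and>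
    (\<lambda>n. poly_op (p n) A) \<longlonglongrightarrow> B)"

end

theory Submission
  imports Defs "HOL-Computational_Algebra.Fundamental_Theorem_Algebra"
begin

text \<open>
  The heart of the matter is the mixed Schwarz inequality
  \<open>\<bar>\<langle>X x, y\<rangle>\<bar> \<le> \<parallel>f(\<bar>X\<bar>) x\<parallel> \<parallel>g(\<bar>X\<^sup>*\<bar>) y\<parallel>\<close> (\<open>mixed_schwarz\<close>). For a unit vector \<open>x\<close>, Jensen's inequality
  for the quadratic form of the functional calculus turns the \<open>r\<close>-th power of the right-hand side
  into the square root of \<open>\<langle>f\<^bsup>2r\<^esup>(\<bar>X\<bar>) x, x\<rangle> \<langle>g\<^bsup>2r\<^esup>(\<bar>X\<^sup>*\<bar>) x, x\<rangle>\<close> (\<open>norm_cfc_powr_le\<close>). The inequality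
  of arithmetic and geometric means then gives the first bound. For the second, the same estimate
  also holds with \<open>X\<^sup>*\<close> for \<open>X\<close>, which has the same numerical values up to conjugation; the two
  estimates are added, and the scalar inequality \<open>\<surd>(a d) + \<surd>(b c) \<le> \<surd>((a + b) (c + d))\<close> collects
  the four forms. Either way the constant is \<open>1/2\<close>, which is at most \<open>2\<^bsup>r - 2\<^esup>\<close> for \<open>r \<ge> 1\<close>.
  
  The mixed Schwarz inequality is derived from the relation \<open>X h(\<bar>X\<bar>) = h(\<bar>X\<^sup>*\<bar>) X\<close>
  (\<open>cfc_abs_op_intertwine\<close>). It lets \<open>g\<close> pass from the right of \<open>X\<close> to the left, so that \<open>X\<close>, up to a
  small error, factors as \<open>g(\<bar>X\<^sup>*\<bar>) C f(\<bar>X\<bar>)\<close> with a contraction \<open>C\<close>.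
  
  Adjoints, square roots and the functional calculus are definite descriptions, so for each of them
  existence and uniqueness have to be shown. Adjoints come from the Riesz representation theorem.
  The calculus rests on the bound of \<open>\<parallel>p(A)\<parallel>\<close> by the supremum of \<open>\<bar>p\<bar>\<close> over the spectrum
  (\<open>norm_poly_op_le\<close>) for polynomials \<open>p\<close> and self-adjoint \<open>A\<close>: writing \<open>l = \<parallel>p(A)\<parallel>\<close>, the operator
  \<open>p(A)\<^sup>2 - l\<^sup>2\<close> is not bounded below; the polynomial \<open>p\<^sup>2 - l\<^sup>2\<close> splits into linear factors over the
  complex numbers, hence some factor \<open>A - z\<close> is not bounded below; and then \<open>z\<close> is a spectral value,
  which is real because \<open>A\<close> is self-adjoint, with \<open>\<bar>p(z)\<bar> = l\<close>. Finally, a positive square root \<open>B\<close> of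
  \<open>T\<close> is unique because the calculus of \<open>T\<close> is that of \<open>B\<close> after the substitution \<open>t \<mapsto> t\<^sup>2\<close>.
\<close>

section \<open>Geometry of the inner product\<close>

lemma cinner_add_right: "cinner x (y + z) = cinner x y + cinner x z"
  for x y z :: "'a::chilbert_space"
  by (metis cinner_add_left cinner_commute complex_cnj_add)

lemma cinner_scaleC_right: "cinner x (c *\<^sub>C y) = cnj c * cinner x y"
  for x y :: "'a::chilbert_space"
  by (metis cinner_scaleC_left cinner_commute complex_cnj_mult)

lemma cinner_self_Im: "Im (cinner x x) = 0"
  for x :: "'a::chilbert_space"
proof -
  have "Im (cinner x x) = - Im (cinner x x)"
    using cinner_commute[of x x] by (metis cnj.simps(2))
  then show ?thesis by simp
qed

lemma Re_cinner_self: "Re (cinner x x) = (norm x)\<^sup>2"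
  for x :: "'a::chilbert_space"
  using norm_eq_sqrt_cinner[of x] norm_ge_zero[of x] by (simp add: real_sqrt_ge_0_iff)

lemma cinner_self: "cinner x x = complex_of_real ((norm x)\<^sup>2)"
  for x :: "'a::chilbert_space"
  by (rule complex_eqI) (simp_all add: Re_cinner_self cinner_self_Im)

lemma norm_scaleC: "norm (c *\<^sub>C x) = cmod c * norm x"
  for x :: "'a::chilbert_space"
proof (rule power2_eq_imp_eq)
  have "cinner (c *\<^sub>C x) (c *\<^sub>C x) = complex_of_real ((cmod c)\<^sup>2 * (norm x)\<^sup>2)"
    unfolding cinner_scaleC_left cinner_scaleC_right unfolding cinner_self
    using complex_norm_square[of c] by (simp add: mult.commute)
  then show "(norm (c *\<^sub>C x))\<^sup>2 = (cmod c * norm x)\<^sup>2"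
    by (metis Re_cinner_self Re_complex_of_real power_mult_distrib)
qed simp_all

interpretation scaleC: bounded_bilinear "scaleC :: complex \<Rightarrow> 'a \<Rightarrow> 'a::chilbert_space"
proof
  show "(r *\<^sub>R a) *\<^sub>C b = r *\<^sub>R (a *\<^sub>C b)" and "a *\<^sub>C (r *\<^sub>R b) = r *\<^sub>R (a *\<^sub>C b)" for r a and b :: 'a
    by (simp_all add: scaleR_scaleC scaleC_scaleC scaleR_conv_of_real mult.commute)
  show "\<exists>K. \<forall>a (b::'a). norm (a *\<^sub>C b) \<le> norm a * norm b * K"
    by (rule exI[of _ 1]) (simp add: norm_scaleC)
qed (simp_all add: scaleC_add_left scaleC_add_right)

lemma cinner_zero_right: "cinner x 0 = 0" for x :: "'a::chilbert_space"
  using cinner_add_right[of x 0 0] by simp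

lemma cinner_minus_left: "cinner (- x) y = - cinner x y" for x :: "'a::chilbert_space"
  using cinner_scaleC_left[of "-1" x y] by (simp add: scaleC.minus_left scaleC_one)

lemma cinner_minus_right: "cinner x (- y) = - cinner x y" for x :: "'a::chilbert_space"
  using cinner_scaleC_right[of x "-1" y] by (simp add: scaleC.minus_left scaleC_one)

lemma cinner_cauchy_schwarz: "cmod (cinner x y) \<le> norm x * norm y"
  for x y :: "'a::chilbert_space"
proof (cases "y = 0")
  case True
  then show ?thesis by (simp add: cinner_zero_right)
next
  case False
  define n where "n = (norm y)\<^sup>2"
  define a where "a = cinner x y"
  have n: "n > 0" using False by (simp add: n_def)
  have yx: "cinner y x = cnj a" unfolding a_def by (rule cinner_commute)
  \<comment> \<open>\<open>u\<close> is \<open>n\<close> times the component of \<open>x\<close> orthogonal to \<open>y\<close>.\<close>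
  define u where "u = of_real n *\<^sub>C x + - (a *\<^sub>C y)"
  have "cinner u u = of_real (n\<^sup>2 * (norm x)\<^sup>2 - n * (cmod a)\<^sup>2)"
    unfolding u_def cinner_add_left cinner_add_right cinner_minus_left cinner_minus_right
      cinner_scaleC_left cinner_scaleC_right
    unfolding yx cinner_self a_def[symmetric] n_def[symmetric]
    using complex_norm_square[of a] by (simp add: algebra_simps power2_eq_square[of "complex_of_real n"])
  then have "n * (n * (norm x)\<^sup>2 - (cmod a)\<^sup>2) \<ge> 0"
    by (metis Re_cinner_self Re_complex_of_real mult.assoc power2_eq_square right_diff_distrib
        zero_le_power2)
  then have "(cmod a)\<^sup>2 \<le> n * (norm x)\<^sup>2"
    using n by (simp add: zero_le_mult_iff)
  then have "(cmod a)\<^sup>2 \<le> (norm x * norm y)\<^sup>2"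
    by (simp add: n_def power_mult_distrib mult.commute)
  then show ?thesis
    unfolding a_def by (rule power2_le_imp_le) simp
qed

interpretation cinner: bounded_bilinear "cinner :: 'a::chilbert_space \<Rightarrow> 'a \<Rightarrow> complex"
proof
  show "cinner (r *\<^sub>R a) b = r *\<^sub>R cinner a b" and "cinner a (r *\<^sub>R b) = r *\<^sub>R cinner a b"
    for r and a b :: 'a
    by (simp_all add: scaleR_scaleC cinner_scaleC_left cinner_scaleC_right scaleR_conv_of_real)
  show "\<exists>K. \<forall>a b::'a. norm (cinner a b) \<le> norm a * norm b * K"
    by (rule exI[of _ 1]) (simp add: cinner_cauchy_schwarz)
qed (simp_all add: cinner_add_left cinner_add_right)

lemma norm_add_square:
  "(norm (x + y))\<^sup>2 = (norm x)\<^sup>2 + 2 * Re (cinner x y) + (norm y)\<^sup>2"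
  for x y :: "'a::chilbert_space"
proof -
  have "Re (cinner y x) = Re (cinner x y)"
    by (subst cinner_commute) simp
  then show ?thesis
    by (simp add: Re_cinner_self[symmetric] cinner_add_left cinner_add_right)
qed

lemma norm_diff_square:
  "(norm (x - y))\<^sup>2 = (norm x)\<^sup>2 - 2 * Re (cinner x y) + (norm y)\<^sup>2"
  for x y :: "'a::chilbert_space"
  using norm_add_square[of x "- y"] by (simp add: cinner.minus_right)

lemma parallelogram:
  "(norm (x - y))\<^sup>2 = 2 * (norm x)\<^sup>2 + 2 * (norm y)\<^sup>2 - (norm (x + y))\<^sup>2"
  for x y :: "'a::chilbert_space"
  by (simp add: norm_add_square norm_diff_square)

lemma cinner_ext: "x = y" if "\<And>z. cinner z x = cinner z y"
  for x y :: "'a::chilbert_space"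
proof -
  have "cinner (x - y) (x - y) = 0"
    by (subst cinner.diff_right) (simp add: that)
  then show ?thesis by (simp add: cinner_self)
qed

section \<open>Riesz representation and adjoints\<close>

text \<open>
  Minimise \<open>J x = \<parallel>x\<parallel>\<^sup>2 - 2 Re (\<phi> x)\<close>, which equals \<open>\<parallel>x - w\<parallel>\<^sup>2 - \<parallel>w\<parallel>\<^sup>2\<close> for the vector \<open>w\<close>
  that is looked for. The parallelogram law makes every minimising sequence Cauchy, and at the
  limit the first variation of \<open>J\<close> vanishes, which is the claim for real parts. Complex linearity
  (replace \<open>x\<close> by \<open>\<i> x\<close>) gives the imaginary parts.
\<close>
lemma riesz_representation:
  fixes \<phi> :: "'a::chilbert_space \<Rightarrow> complex"
  assumes bl: "bounded_linear \<phi>" and lin: "\<And>c x. \<phi> (c *\<^sub>C x) = c * \<phi> x"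
  shows "\<exists>w. \<forall>x. \<phi> x = cinner x w"
proof -
  interpret \<phi>: bounded_linear \<phi> by (rule bl)
  define J where "J x = (norm x)\<^sup>2 - 2 * Re (\<phi> x)" for x
  obtain K where K: "\<And>x. cmod (\<phi> x) \<le> norm x * K"
    using \<phi>.bounded by blast
  have "J x \<ge> - K\<^sup>2" for x
  proof -
    have "Re (\<phi> x) \<le> norm x * K"
      using complex_Re_le_cmod[of "\<phi> x"] K[of x] by linarith
    moreover have "(norm x - K)\<^sup>2 \<ge> 0" by simp
    ultimately show ?thesis unfolding J_def power2_diff by linarith
  qed
  then have bdd: "bdd_below (range J)" by (intro bdd_belowI[of _ "- K\<^sup>2"]) auto
  define d where "d = Inf (range J)"
  have d: "d \<le> J x" for x unfolding d_def by (rule cInf_lower[OF _ bdd]) simp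
  have "\<exists>x. J x < d + inverse (Suc n)" for n
  proof -
    have "\<exists>y\<in>range J. y < d + inverse (Suc n)"
      by (subst cInf_less_iff[OF _ bdd, symmetric]) (auto simp: d_def)
    then show ?thesis by auto
  qed
  then obtain z where z: "\<And>n. J (z n) < d + inverse (real (Suc n))" by metis
  have mid: "(norm (x - y))\<^sup>2 \<le> 2 * J x + 2 * J y - 4 * d" for x y
  proof -
    have "J ((1/2) *\<^sub>R (x + y)) = (norm (x + y))\<^sup>2 / 4 - Re (\<phi> x) - Re (\<phi> y)"
      by (simp add: J_def \<phi>.scaleR \<phi>.add power_divide add_divide_distrib
          norm_scaleR power_mult_distrib del: scaleR_add_right scaleR_half_double)
    with d[of "(1/2) *\<^sub>R (x + y)"] have "d \<le> (norm (x + y))\<^sup>2 / 4 - Re (\<phi> x) - Re (\<phi> y)"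
      by simp
    then show ?thesis
      unfolding parallelogram[of x y] J_def[of x] J_def[of y] by (simp add: field_simps)
  qed
  have "Cauchy z"
  proof (rule metric_CauchyI)
    fix e :: real assume e: "e > 0"
    have "e\<^sup>2 / 4 > 0" using e by simp
    then obtain N where N: "inverse (real (Suc N)) < e\<^sup>2 / 4"
      using reals_Archimedean by blast
    then have N: "4 * inverse (real (Suc N)) < e\<^sup>2" by (simp add: field_simps)
    have small: "4 * J (z n) - 4 * d < e\<^sup>2" if "n \<ge> N" for n
    proof -
      have "inverse (real (Suc n)) \<le> inverse (real (Suc N))"
        using that by (intro le_imp_inverse_le) auto
      then show ?thesis using z[of n] N by linarith
    qed
    have "dist (z m) (z n) < e" if "m \<ge> N" "n \<ge> N" for m n
    proof -
      have "(norm (z m - z n))\<^sup>2 < e\<^sup>2"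
        using mid[of "z m" "z n"] small[OF that(1)] small[OF that(2)] by linarith
      then show ?thesis using e by (simp add: dist_norm power2_less_imp_less)
    qed
    then show "\<exists>M. \<forall>m\<ge>M. \<forall>n\<ge>M. dist (z m) (z n) < e" by blast
  qed
  then obtain w where w: "z \<longlonglongrightarrow> w"
    using Cauchy_convergent_iff convergent_def by blast
  have "(\<lambda>n. J (z n)) \<longlonglongrightarrow> J w"
    unfolding J_def by (intro tendsto_intros \<phi>.tendsto w)
  moreover have "(\<lambda>n. d + inverse (real (Suc n))) \<longlonglongrightarrow> d + 0"
    by (intro tendsto_intros LIMSEQ_inverse_real_of_nat)
  ultimately have Jw: "J w \<le> d"
    using LIMSEQ_le[of "\<lambda>n. J (z n)" "J w" "\<lambda>n. d + inverse (real (Suc n))" d] z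
    by (metis add.right_neutral less_imp_le)
  have Re_eq: "Re (\<phi> x) = Re (cinner x w)" for x
  proof -
    define b where "b = Re (cinner x w) - Re (\<phi> x)"
    have quad: "0 \<le> t\<^sup>2 * (norm x)\<^sup>2 + 2 * t * b" for t :: real
    proof -
      have "J w \<le> J (t *\<^sub>R x + w)" using Jw d order_trans by blast
      then show ?thesis
        unfolding J_def norm_add_square
        by (simp add: \<phi>.add \<phi>.scaleR cinner.scaleR_left b_def power_mult_distrib algebra_simps)
    qed
    have "b = 0"
    proof (rule ccontr)
      assume "b \<noteq> 0"
      define s where "s = (norm x)\<^sup>2 + 1"
      have s: "s > 0" by (simp add: s_def add_nonneg_pos)
      \<comment> \<open>At \<open>t = - b / s\<close> the quadratic in \<open>t\<close> is at most \<open>- b\<^sup>2 / s\<close>.\<close>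
      have "0 \<le> (- b / s)\<^sup>2 * (norm x)\<^sup>2 + 2 * (- b / s) * b" by (rule quad)
      also have "\<dots> \<le> (- b / s)\<^sup>2 * s + 2 * (- b / s) * b"
        by (intro add_right_mono mult_left_mono) (simp_all add: s_def)
      also have "\<dots> = - (b\<^sup>2 / s)"
        using s by (simp add: field_simps power2_eq_square)
      finally show False using s \<open>b \<noteq> 0\<close> by (simp add: divide_le_0_iff)
    qed
    then show ?thesis by (simp add: b_def)
  qed
  have "\<phi> x = cinner x w" for x
  proof (rule complex_eqI)
    have "Re (\<phi> (\<i> *\<^sub>C x)) = Re (cinner (\<i> *\<^sub>C x) w)" by (rule Re_eq)
    then show "Im (\<phi> x) = Im (cinner x w)" by (simp add: lin cinner_scaleC_left)
  qed (rule Re_eq)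
  then show ?thesis by blast
qed

lemma bounded_opsD: "A \<in> bounded_ops \<Longrightarrow> blinfun_apply A (c *\<^sub>C x) = c *\<^sub>C blinfun_apply A x"
  by (simp add: bounded_ops_def)

text \<open>
  The value of the adjoint at \<open>y\<close> is the Riesz vector of \<open>x \<mapsto> \<langle>A x, y\<rangle>\<close>.
\<close>
lemma adjoint_exists:
  assumes A: "A \<in> bounded_ops"
  shows "\<exists>B\<in>bounded_ops. \<forall>x y. cinner (blinfun_apply A x) y = cinner x (blinfun_apply B y)"
proof -
  have "\<exists>w. \<forall>x. cinner (blinfun_apply A x) y = cinner x w" for y
    by (rule riesz_representation[of "\<lambda>x. cinner (blinfun_apply A x) y"])
      (auto intro!: cinner.bounded_linear_left bounded_linear_compose[OF cinner.bounded_linear_left]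
        blinfun.bounded_linear_right simp: bounded_opsD[OF A] cinner_scaleC_left)
  then obtain b where b: "\<And>x y. cinner (blinfun_apply A x) y = cinner x (b y)" by metis
  have lin: "bounded_linear b"
  proof (rule bounded_linear_intro[where K = "norm A"])
    show "b (x + y) = b x + b y" for x y
      by (rule cinner_ext) (simp add: cinner_add_right flip: b)
    show "b (r *\<^sub>R x) = r *\<^sub>R b x" for r x
      by (rule cinner_ext) (simp add: cinner.scaleR_right flip: b)
    show "norm (b y) \<le> norm y * norm A" for y
    proof (cases "b y = 0")
      case False
      have "(norm (b y))\<^sup>2 = cmod (cinner (blinfun_apply A (b y)) y)"
        unfolding b cinner_self by (simp add: norm_power)
      also have "\<dots> \<le> norm (blinfun_apply A (b y)) * norm y" by (rule cinner_cauchy_schwarz)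
      also have "\<dots> \<le> norm A * norm (b y) * norm y"
        by (intro mult_right_mono norm_blinfun) simp
      finally show ?thesis using False by (simp add: power2_eq_square ac_simps)
    qed simp
  qed
  have "b (c *\<^sub>C y) = c *\<^sub>C b y" for c y
    by (rule cinner_ext) (simp add: cinner_scaleC_right flip: b)
  then have "Blinfun b \<in> bounded_ops"
    by (simp add: bounded_ops_def bounded_linear_Blinfun_apply[OF lin])
  then show ?thesis
    using b by (intro bexI[of _ "Blinfun b"]) (simp_all add: bounded_linear_Blinfun_apply[OF lin])
qed

lemma
  assumes A: "A \<in> bounded_ops"
  shows adj_bounded_ops: "adj A \<in> bounded_ops"
    and cinner_adj_right: "cinner (blinfun_apply A x) y = cinner x (blinfun_apply (adj A) y)"
proof -
  obtain B where B: "B \<in> bounded_ops"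
      "\<forall>x y. cinner (blinfun_apply A x) y = cinner x (blinfun_apply B y)"
    using adjoint_exists[OF A] by blast
  have "adj A = B"
    unfolding adj_def
  proof (rule the_equality)
    show "C = B" if "C \<in> bounded_ops \<and>
        (\<forall>x y. cinner (blinfun_apply A x) y = cinner x (blinfun_apply C y))" for C
      using that B by (intro blinfun_eqI cinner_ext) metis
  qed (use B in blast)
  then show "adj A \<in> bounded_ops"
    "cinner (blinfun_apply A x) y = cinner x (blinfun_apply (adj A) y)"
    using B by auto
qed

lemma cinner_adj_left:
  "A \<in> bounded_ops \<Longrightarrow> cinner (blinfun_apply (adj A) x) y = cinner x (blinfun_apply A y)"
  by (metis cinner_adj_right cinner_commute)

lemma adj_adj: "A \<in> bounded_ops \<Longrightarrow> adj (adj A) = A"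
  by (intro blinfun_eqI cinner_ext)
    (metis adj_bounded_ops cinner_adj_left cinner_adj_right)

lemma compose_bounded_ops: "A \<in> bounded_ops \<Longrightarrow> B \<in> bounded_ops \<Longrightarrow> A o\<^sub>L B \<in> bounded_ops"
  by (simp add: bounded_ops_def)

section \<open>Self-adjoint and positive operators\<close>

definition selfadjoint_op :: "('a::chilbert_space \<Rightarrow>\<^sub>L 'a) \<Rightarrow> bool"
  where "selfadjoint_op A \<longleftrightarrow> A \<in> bounded_ops \<and>
    (\<forall>x y. cinner (blinfun_apply A x) y = cinner x (blinfun_apply A y))"

lemma selfadjoint_opD:
  assumes "selfadjoint_op A"
  shows "A \<in> bounded_ops" and "cinner (blinfun_apply A x) y = cinner x (blinfun_apply A y)"
  using assms by (auto simp: selfadjoint_op_def)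

text \<open>
  Polarisation over the complex numbers: the quadratic form is real at \<open>x + y\<close> and at \<open>x + \<i> y\<close>,
  which pins down the imaginary and the real part of \<open>\<langle>A x, y\<rangle> - \<langle>x, A y\<rangle>\<close>.
\<close>
lemma positive_op_selfadjoint:
  assumes "positive_op A"
  shows "selfadjoint_op A"
proof -
  have A: "A \<in> bounded_ops" and real: "Im (cinner (blinfun_apply A x) x) = 0" for x
    using assms by (auto simp: positive_op_def complex_is_Real_iff)
  have "cinner (blinfun_apply A x) y = cinner x (blinfun_apply A y)" for x y
  proof -
    define a b where "a = cinner (blinfun_apply A x) y" and "b = cinner (blinfun_apply A y) x"
    have "Im (a + b) = 0"
      using real[of "x + y"] real[of x] real[of y]
      by (simp add: a_def b_def blinfun.add_right cinner_add_left cinner_add_right)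
    moreover have "Re (a - b) = 0"
      using real[of "x + \<i> *\<^sub>C y"] real[of x] real[of y]
      by (simp add: a_def b_def blinfun.add_right bounded_opsD[OF A] cinner_add_left
          cinner_add_right cinner_scaleC_left cinner_scaleC_right)
    ultimately have "a = cnj b" by (simp add: complex_eq_iff)
    then show ?thesis unfolding a_def b_def by (metis cinner_commute)
  qed
  with A show ?thesis by (simp add: selfadjoint_op_def)
qed

section \<open>Spectrum\<close>

text \<open>
  Failure of this property for \<open>A - z\<close> says that \<open>z\<close> is an approximate eigenvalue. If it fails for a
  product then it fails for some factor, and this is how spectral values are found below. It is stated for
  functions, so that it applies to complex polynomials of \<open>A\<close> as well.
\<close>
definition bounded_below :: "('a::real_normed_vector \<Rightarrow> 'b::real_normed_vector) \<Rightarrow> bool"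
  where "bounded_below T \<longleftrightarrow> (\<exists>c>0. \<forall>x. c * norm x \<le> norm (T x))"

lemma bounded_below_compose:
  assumes "bounded_below S" and "bounded_below T"
  shows "bounded_below (\<lambda>x. S (T x))"
proof -
  obtain c d where c: "c > 0" "\<And>x. c * norm x \<le> norm (S x)"
    and d: "d > 0" "\<And>x. d * norm x \<le> norm (T x)"
    using assms by (auto simp: bounded_below_def)
  have "c * d * norm x \<le> norm (S (T x))" for x
    using mult_left_mono[OF d(2)[of x], of c] c(2)[of "T x"] c(1) unfolding mult.assoc by linarith
  then show ?thesis using c(1) d(1) unfolding bounded_below_def by (intro exI[of _ "c * d"]) simp
qed

lemma not_bounded_below_imp_spectrum:
  assumes "\<not> bounded_below (\<lambda>x. blinfun_apply A x - z *\<^sub>C x)"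
  shows "z \<in> spectrum_op A"
proof (rule ccontr)
  assume "z \<notin> spectrum_op A"
  then obtain B where B: "\<And>x. blinfun_apply B (blinfun_apply A x - z *\<^sub>C x) = x"
    unfolding spectrum_op_def by blast
  have B1: "norm B + 1 > 0" by (simp add: add_nonneg_pos)
  have "inverse (norm B + 1) * norm x \<le> norm (blinfun_apply A x - z *\<^sub>C x)" for x
  proof -
    have "norm x \<le> norm B * norm (blinfun_apply A x - z *\<^sub>C x)"
      using norm_blinfun[of B "blinfun_apply A x - z *\<^sub>C x"] by (simp add: B)
    also have "\<dots> \<le> (norm B + 1) * norm (blinfun_apply A x - z *\<^sub>C x)"
      by (intro mult_right_mono) simp_all
    finally show ?thesis 
      unfolding divide_inverse_commute[symmetric] using B1 by (simp add: pos_divide_le_eq mult.commute)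
  qed
  then show False
    using assms unfolding bounded_below_def
    by (metis add_nonneg_pos norm_ge_zero positive_imp_inverse_positive zero_less_one)
qed

text \<open>
  The imaginary part of \<open>\<langle>(A - z) x, x\<rangle>\<close> is \<open>- Im z \<parallel>x\<parallel>\<^sup>2\<close>, so \<open>\<bar>Im z\<bar>\<close> is a lower bound.
\<close>
lemma selfadjoint_bounded_below_nonreal:
  assumes A: "selfadjoint_op A" and z: "Im z \<noteq> 0"
  shows "bounded_below (\<lambda>x. blinfun_apply A x - z *\<^sub>C x)"
proof -
  have "\<bar>Im z\<bar> * norm x \<le> norm (blinfun_apply A x - z *\<^sub>C x)" for x
  proof (cases "x = 0")
    case False
    have "Im (cinner (blinfun_apply A x) x) = 0"
      using selfadjoint_opD(2)[OF A, of x x] by (metis cinner_commute Reals_cnj_iff complex_is_Real_iff)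
    then have "Im (cinner (blinfun_apply A x - z *\<^sub>C x) x) = - Im z * (norm x)\<^sup>2"
      by (simp add: cinner.diff_left cinner_scaleC_left cinner_self flip: of_real_power)
    then have "\<bar>Im z\<bar> * (norm x)\<^sup>2 \<le> cmod (cinner (blinfun_apply A x - z *\<^sub>C x) x)"
      using abs_Im_le_cmod[of "cinner (blinfun_apply A x - z *\<^sub>C x) x"] by (simp add: abs_mult)
    also have "\<dots> \<le> norm (blinfun_apply A x - z *\<^sub>C x) * norm x" by (rule cinner_cauchy_schwarz)
    finally show ?thesis using False by (simp add: power2_eq_square)
  qed simp
  then show ?thesis using z unfolding bounded_below_def by (intro exI[of _ "\<bar>Im z\<bar>"]) simp
qed

text \<open>
  The Lax--Milgram argument: for small \<open>\<rho> > 0\<close> the map \<open>x \<mapsto> x - \<rho> (T x - y)\<close> is a contraction,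
  and its fixed point solves \<open>T x = y\<close>.
\<close>
lemma coercive_invertible:
  assumes T: "T \<in> bounded_ops" and c: "c > 0"
    and coercive: "\<And>x. c * (norm x)\<^sup>2 \<le> Re (cinner (blinfun_apply T x) x)"
  shows "\<exists>B\<in>bounded_ops. \<forall>x. blinfun_apply T (blinfun_apply B x) = x \<and>
    blinfun_apply B (blinfun_apply T x) = x"
proof -
  have below: "c * norm x \<le> norm (blinfun_apply T x)" for x
  proof (cases "x = 0")
    case False
    have "c * (norm x)\<^sup>2 \<le> norm (blinfun_apply T x) * norm x"
      using coercive[of x] complex_Re_le_cmod[of "cinner (blinfun_apply T x) x"]
        cinner_cauchy_schwarz[of "blinfun_apply T x" x] by linarith
    then show ?thesis using False by (simp add: power2_eq_square)
  qed simp
  \<comment> \<open>The estimate below is \<open>\<parallel>x - \<rho> T x\<parallel>\<^sup>2 \<le> (1 - 2 \<rho> c + \<rho>\<^sup>2 \<parallel>T\<parallel>\<^sup>2) \<parallel>x\<parallel>\<^sup>2\<close>. Any \<open>M \<ge> \<parallel>T\<parallel>\<^sup>2\<close> with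
    \<open>\<rho> = c / M\<close> gives at most \<open>1 - c\<^sup>2 / M\<close>, and \<open>M > c\<^sup>2\<close> keeps this positive.\<close>
  define M where "M = (norm T)\<^sup>2 + c\<^sup>2 + 1"
  have M: "M > 0" "c\<^sup>2 < M" "(norm T)\<^sup>2 \<le> M"
    by (simp_all add: M_def add_nonneg_pos add_pos_nonneg)
  define \<rho> where "\<rho> = c / M"
  have q: "0 \<le> 1 - c\<^sup>2 / M" "1 - c\<^sup>2 / M < 1" using M c by (simp_all add: field_simps)
  have contr: "norm (x - \<rho> *\<^sub>R blinfun_apply T x) \<le> sqrt (1 - c\<^sup>2 / M) * norm x" for x
  proof -
    have "(norm (blinfun_apply T x))\<^sup>2 \<le> (norm T)\<^sup>2 * (norm x)\<^sup>2"
      unfolding power_mult_distrib[symmetric] by (intro power_mono norm_blinfun) simp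
    also have "\<dots> \<le> M * (norm x)\<^sup>2" by (intro mult_right_mono M) simp
    finally have "\<rho>\<^sup>2 * (norm (blinfun_apply T x))\<^sup>2 \<le> \<rho>\<^sup>2 * (M * (norm x)\<^sup>2)"
      by (intro mult_left_mono) simp_all
    also have "\<dots> = c\<^sup>2 / M * (norm x)\<^sup>2"
      using M(1) by (simp add: \<rho>_def power2_eq_square)
    finally have 1: "\<rho>\<^sup>2 * (norm (blinfun_apply T x))\<^sup>2 \<le> c\<^sup>2 / M * (norm x)\<^sup>2" .
    have "\<rho> * (c * (norm x)\<^sup>2) \<le> \<rho> * Re (cinner (blinfun_apply T x) x)"
      using M(1) c by (intro mult_left_mono coercive) (simp add: \<rho>_def)
    then have 2: "c\<^sup>2 / M * (norm x)\<^sup>2 \<le> \<rho> * Re (cinner (blinfun_apply T x) x)"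
      by (simp add: \<rho>_def power2_eq_square)
    have "Re (cinner x (blinfun_apply T x)) = Re (cinner (blinfun_apply T x) x)"
      by (subst cinner_commute) simp
    then have "(norm (x - \<rho> *\<^sub>R blinfun_apply T x))\<^sup>2 =
        (norm x)\<^sup>2 - 2 * (\<rho> * Re (cinner (blinfun_apply T x) x)) + \<rho>\<^sup>2 * (norm (blinfun_apply T x))\<^sup>2"
      unfolding norm_diff_square by (simp add: cinner.scaleR_right power_mult_distrib)
    also have "\<dots> \<le> (norm x)\<^sup>2 - c\<^sup>2 / M * (norm x)\<^sup>2"
      using 1 2 by linarith
    also have "\<dots> = (1 - c\<^sup>2 / M) * (norm x)\<^sup>2" by (simp add: left_diff_distrib)
    also have "\<dots> = (sqrt (1 - c\<^sup>2 / M) * norm x)\<^sup>2"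
      using q by (simp add: power_mult_distrib)
    finally show ?thesis by (rule power2_le_imp_le) (use q in simp)
  qed
  have "\<exists>!x. x - \<rho> *\<^sub>R (blinfun_apply T x - y) = x" for y
  proof (rule banach_fix_type[of "sqrt (1 - c\<^sup>2 / M)"])
    show "\<forall>x z. dist (x - \<rho> *\<^sub>R (blinfun_apply T x - y)) (z - \<rho> *\<^sub>R (blinfun_apply T z - y))
        \<le> sqrt (1 - c\<^sup>2 / M) * dist x z"
    proof (intro allI)
      fix x z
      have "x - \<rho> *\<^sub>R (blinfun_apply T x - y) - (z - \<rho> *\<^sub>R (blinfun_apply T z - y)) =
          (x - z) - \<rho> *\<^sub>R blinfun_apply T (x - z)"
        by (simp add: blinfun.diff_right scaleR_diff_right)
      note eq = this
      show "dist (x - \<rho> *\<^sub>R (blinfun_apply T x - y)) (z - \<rho> *\<^sub>R (blinfun_apply T z - y))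
          \<le> sqrt (1 - c\<^sup>2 / M) * dist x z"
        using contr[of "x - z"] by (simp only: dist_norm eq)
    qed
  qed (use q in \<open>simp_all add: real_sqrt_lt_1_iff\<close>)
  then have "\<exists>x. x - \<rho> *\<^sub>R (blinfun_apply T x - y) = x" for y by blast
  then have "\<exists>x. blinfun_apply T x = y" for y
    using M(1) c by (simp add: \<rho>_def)
  then obtain b where b: "\<And>y. blinfun_apply T (b y) = y" by metis
  have inj: "x = y" if "blinfun_apply T x = blinfun_apply T y" for x y
    using below[of "x - y"] that c by (simp add: blinfun.diff_right mult_le_0_iff)
  have lin: "bounded_linear b"
  proof (rule bounded_linear_intro[where K = "inverse c"])
    show "b (x + y) = b x + b y" for x y by (rule inj) (simp add: b blinfun.add_right)
    show "b (r *\<^sub>R x) = r *\<^sub>R b x" for r x by (rule inj) (simp add: b blinfun.scaleR_right)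
    show "norm (b y) \<le> norm y * inverse c" for y
      using below[of "b y"] c by (simp add: b field_simps)
  qed
  have "b (z *\<^sub>C x) = z *\<^sub>C b x" for z x by (rule inj) (simp add: b bounded_opsD[OF T])
  then have "Blinfun b \<in> bounded_ops"
    by (simp add: bounded_ops_def bounded_linear_Blinfun_apply[OF lin])
  moreover have "b (blinfun_apply T x) = x" for x by (rule inj) (rule b)
  ultimately show ?thesis
    by (intro bexI[of _ "Blinfun b"]) (simp_all add: b bounded_linear_Blinfun_apply[OF lin])
qed

text \<open>
  For \<open>t < 0\<close> the operator \<open>A - t\<close> is coercive, for \<open>t > \<parallel>A\<parallel>\<close> its negative is; the sign is the
  variable \<open>s\<close> of the proof. Hence uniform approximation on \<open>[0, \<parallel>A\<parallel>]\<close> implies uniform approximation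
  on the spectrum.
\<close>
lemma positive_op_spectrum:
  assumes A: "positive_op A" and t: "complex_of_real t \<in> spectrum_op A"
  shows "t \<in> {0..norm A}"
proof (rule ccontr)
  have AB: "A \<in> bounded_ops" and pos: "\<And>x. 0 \<le> Re (cinner (blinfun_apply A x) x)"
    using A by (auto simp: positive_op_def)
  have lin: "A - t *\<^sub>R id_blinfun \<in> bounded_ops"
    unfolding bounded_ops_def using bounded_opsD[OF AB]
    by (simp add: blinfun.diff_left blinfun.scaleR_left scaleR_scaleC scaleC_scaleC mult.commute
        scaleC.diff_right)
  have notin: "complex_of_real t \<notin> spectrum_op A"
    if B: "B \<in> bounded_ops"
      and inv: "\<And>x. s *\<^sub>R (blinfun_apply A (blinfun_apply B x) - t *\<^sub>R blinfun_apply B x) = x"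
        "\<And>x. s *\<^sub>R blinfun_apply B (blinfun_apply A x - t *\<^sub>R x) = x"
    for B and s :: real
  proof -
    have "s *\<^sub>R B \<in> bounded_ops"
      unfolding bounded_ops_def using bounded_opsD[OF B]
      by (simp add: blinfun.scaleR_left scaleR_scaleC scaleC_scaleC mult.commute)
    moreover have "blinfun_apply (s *\<^sub>R B) (blinfun_apply A x - complex_of_real t *\<^sub>C x) = x" for x
      using inv(2)[of x] by (simp add: blinfun.scaleR_left scaleR_scaleC[of t])
    moreover have "blinfun_apply A (blinfun_apply (s *\<^sub>R B) x) -
        complex_of_real t *\<^sub>C blinfun_apply (s *\<^sub>R B) x = x" for x
      using inv(1)[of x]
      by (simp add: blinfun.scaleR_left blinfun.scaleR_right scaleC.scaleR_right scaleR_diff_right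
          flip: scaleR_scaleC)
    ultimately show ?thesis unfolding spectrum_op_def by blast
  qed
  assume "t \<notin> {0..norm A}"
  then consider "t < 0" | "t > norm A" by fastforce
  then show False
  proof cases
    case 1
    have "\<exists>B\<in>bounded_ops. \<forall>x. blinfun_apply (A - t *\<^sub>R id_blinfun) (blinfun_apply B x) = x \<and>
        blinfun_apply B (blinfun_apply (A - t *\<^sub>R id_blinfun) x) = x"
    proof (rule coercive_invertible[OF lin, of "- t"])
      show "- t * (norm x)\<^sup>2 \<le> Re (cinner (blinfun_apply (A - t *\<^sub>R id_blinfun) x) x)" for x
        using pos[of x]
        by (simp add: blinfun.diff_left blinfun.scaleR_left cinner.diff_left cinner.scaleR_left
            Re_cinner_self)
    qed (use 1 in simp)
    then show False using notin[of _ 1] t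
      by (auto simp: blinfun.diff_left blinfun.scaleR_left)
  next
    case 2
    have lin': "- (A - t *\<^sub>R id_blinfun) \<in> bounded_ops"
      using lin by (simp add: bounded_ops_def blinfun.minus_left scaleC.minus_right
          del: minus_diff_eq)
    have "\<exists>B\<in>bounded_ops. \<forall>x. blinfun_apply (- (A - t *\<^sub>R id_blinfun)) (blinfun_apply B x) = x \<and>
        blinfun_apply B (blinfun_apply (- (A - t *\<^sub>R id_blinfun)) x) = x"
    proof (rule coercive_invertible[OF lin', of "t - norm A"])
      fix x
      have "Re (cinner (blinfun_apply A x) x) \<le> norm (blinfun_apply A x) * norm x"
        using complex_Re_le_cmod cinner_cauchy_schwarz order_trans by blast
      also have "\<dots> \<le> norm A * norm x * norm x" by (intro mult_right_mono norm_blinfun) simp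
      finally show "(t - norm A) * (norm x)\<^sup>2
          \<le> Re (cinner (blinfun_apply (- (A - t *\<^sub>R id_blinfun)) x) x)"
        by (simp add: blinfun.diff_left blinfun.scaleR_left blinfun.minus_left cinner.diff_left
            cinner.scaleR_left Re_cinner_self left_diff_distrib power2_eq_square)
    qed (use 2 in simp)
    then show False using notin[of _ "- 1"] t
      by (auto simp: blinfun.diff_left blinfun.scaleR_left blinfun.minus_left blinfun.minus_right
          blinfun.diff_right)
  qed
qed

section \<open>Polynomials of an operator\<close>

lemma poly_op_0 [simp]: "poly_op 0 A = 0"
  by (simp add: poly_op_def)

lemma poly_op_pCons [simp]: "poly_op (pCons a p) A = a *\<^sub>R id_blinfun + (A o\<^sub>L poly_op p A)"
proof (cases "p = 0")
  case True
  then show ?thesis by (simp add: poly_op_def)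
next
  case False
  then show ?thesis
    by (intro blinfun_eqI)
      (simp add: poly_op_def sum.atMost_Suc_shift blinfun.add_left blinfun.sum_left blinfun.sum_right
        blinfun.scaleR_left blinfun.scaleR_right del: sum.atMost_Suc)
qed

lemma poly_op_add: "poly_op (p + q) A = poly_op p A + poly_op q A"
proof (induction p q rule: poly_induct2)
  case (pCons a p b q)
  then show ?case
    by (intro blinfun_eqI) (simp add: blinfun.add_left blinfun.add_right scaleR_add_left blinfun.scaleR_left)
qed simp

lemma poly_op_smult: "poly_op (smult c p) A = c *\<^sub>R poly_op p A"
  by (induction p)
    (auto intro!: blinfun_eqI simp: blinfun.add_left blinfun.scaleR_left blinfun.scaleR_right
      scaleR_add_right)

lemma poly_op_diff: "poly_op (p - q) A = poly_op p A - poly_op q A"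
  using poly_op_add[of p "smult (- 1) q" A] by (simp only: poly_op_smult) simp

lemma poly_op_mult: "poly_op (p * q) A = poly_op p A o\<^sub>L poly_op q A"
  by (induction p)
    (auto intro!: blinfun_eqI simp: poly_op_add poly_op_smult blinfun.add_left blinfun.scaleR_left)

lemma poly_op_pcompose: "poly_op (p \<circ>\<^sub>p q) A = poly_op p (poly_op q A)"
  by (induction p)
    (auto intro!: blinfun_eqI simp: pcompose_pCons poly_op_add poly_op_mult blinfun.add_left)

lemma selfadjoint_poly_op:
  assumes A: "selfadjoint_op A"
  shows "selfadjoint_op (poly_op p A)"
proof -
  have "(\<forall>c x. blinfun_apply (poly_op p A) (c *\<^sub>C x) = c *\<^sub>C blinfun_apply (poly_op p A) x) \<and>
    (\<forall>x y. cinner (blinfun_apply (poly_op p A) x) y = cinner x (blinfun_apply (poly_op p A) y)) \<and>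
    (\<forall>x. blinfun_apply (poly_op p A) (blinfun_apply A x) =
      blinfun_apply A (blinfun_apply (poly_op p A) x))"
    by (induction p)
      (simp_all add: blinfun.add_left blinfun.add_right blinfun.scaleR_left blinfun.scaleR_right
        bounded_opsD[OF selfadjoint_opD(1)[OF A]] selfadjoint_opD(2)[OF A] scaleR_scaleC
        scaleC_scaleC mult.commute scaleC.add_right cinner_add_left cinner_add_right
        cinner_scaleC_left cinner_scaleC_right blinfun.zero_left cinner.zero_left cinner.zero_right
        scaleC.zero_right)
  then show ?thesis by (simp add: selfadjoint_op_def bounded_ops_def)
qed

section \<open>The norm of a polynomial of a self-adjoint operator\<close>

text \<open>
  The value at \<open>x\<close> of a complex polynomial of \<open>A\<close>, by Horner's scheme. It is a function and not a
  bounded map of type \<open>\<Rightarrow>\<^sub>L\<close>, because that type carries real scalars only. Complex coefficients are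
  what allows splitting into linear factors.
\<close>
definition cpoly_apply :: "complex poly \<Rightarrow> ('a::chilbert_space \<Rightarrow>\<^sub>L 'a) \<Rightarrow> 'a \<Rightarrow> 'a"
  where "cpoly_apply q A = fold_coeffs (\<lambda>c v x. c *\<^sub>C x + blinfun_apply A (v x)) q (\<lambda>x. 0)"

lemma cpoly_apply_0 [simp]: "cpoly_apply 0 A x = 0"
  by (simp add: cpoly_apply_def)

lemma cpoly_apply_pCons [simp]:
  "cpoly_apply (pCons c q) A x = c *\<^sub>C x + blinfun_apply A (cpoly_apply q A x)"
  by (cases "q = 0 \<and> c = 0")
    (auto simp: cpoly_apply_def scaleC.zero_left blinfun.zero_right)

lemma cpoly_apply_add: "cpoly_apply (p + q) A x = cpoly_apply p A x + cpoly_apply q A x"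
  by (induction p q rule: poly_induct2) (simp_all add: blinfun.add_right scaleC_add_left)

lemma cpoly_apply_smult:
  "A \<in> bounded_ops \<Longrightarrow> cpoly_apply (smult c q) A x = c *\<^sub>C cpoly_apply q A x"
  by (induction q) (simp_all add: scaleC.zero_right scaleC_add_right scaleC_scaleC bounded_opsD)

lemma cpoly_apply_linear_factor:
  assumes "A \<in> bounded_ops"
  shows "cpoly_apply ([:- z, 1:] * q) A =
    (\<lambda>x. blinfun_apply A (cpoly_apply q A x) - z *\<^sub>C cpoly_apply q A x)"
proof
  fix x
  have "[:- z, 1:] * q = smult (- z) q + pCons 0 q" by simp
  then show "cpoly_apply ([:- z, 1:] * q) A x =
      blinfun_apply A (cpoly_apply q A x) - z *\<^sub>C cpoly_apply q A x"
    by (simp only: cpoly_apply_add cpoly_apply_smult[OF assms] cpoly_apply_pCons)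
      (simp add: scaleC.minus_left scaleC.zero_left)
qed

lemma cpoly_apply_of_real:
  "cpoly_apply (map_poly complex_of_real p) A = blinfun_apply (poly_op p A)"
proof
  show "cpoly_apply (map_poly complex_of_real p) A x = blinfun_apply (poly_op p A) x" for x
    by (induction p) (simp_all add: map_poly_pCons blinfun.add_left blinfun.scaleR_left
        scaleR_scaleC blinfun.zero_left)
qed

text \<open>
  By the fundamental theorem of algebra \<open>q(A)\<close> is a product of factors \<open>A - z\<close> over the roots of \<open>q\<close>.
\<close>
lemma bounded_below_cpoly_apply:
  assumes A: "A \<in> bounded_ops"
  shows "q \<noteq> 0 \<Longrightarrow>
    (\<And>z. poly q z = 0 \<Longrightarrow> bounded_below (\<lambda>x. blinfun_apply A x - z *\<^sub>C x)) \<Longrightarrow>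
    bounded_below (cpoly_apply q A)"
proof (induction "degree q" arbitrary: q)
  case 0
  then obtain c where q: "q = [:c:]" by (metis degree_eq_zeroE)
  with 0 show ?case
    unfolding bounded_below_def
    by (intro exI[of _ "cmod c"]) (simp add: norm_scaleC blinfun.zero_right)
next
  case (Suc n)
  then have "\<not> constant (poly q)" by (simp add: constant_degree)
  then obtain z where z: "poly q z = 0" using fundamental_theorem_of_algebra by blast
  then obtain k where k: "q = [:- z, 1:] * k" by (metis poly_eq_0_iff_dvd dvdE)
  with Suc.prems have "k \<noteq> 0" by auto
  then have "degree q = Suc (degree k)" unfolding k by (subst degree_mult_eq) simp_all
  then have "n = degree k" using Suc.hyps by simp
  moreover have "bounded_below (\<lambda>x. blinfun_apply A x - w *\<^sub>C x)" if "poly k w = 0" for w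
    using Suc.prems(2)[of w] that by (simp add: k)
  ultimately have "bounded_below (cpoly_apply k A)" using Suc.hyps(1) \<open>k \<noteq> 0\<close> by blast
  then have "bounded_below (\<lambda>x. blinfun_apply A (cpoly_apply k A x) - z *\<^sub>C cpoly_apply k A x)"
    by (rule bounded_below_compose[OF Suc.prems(2)[OF z]])
  then show ?case unfolding k by (simp only: cpoly_apply_linear_factor[OF A])
qed

lemma poly_op_not_bounded_below_imp_root:
  assumes A: "selfadjoint_op A" and q: "q \<noteq> 0"
    and nb: "\<not> bounded_below (blinfun_apply (poly_op q A))"
  shows "\<exists>t. complex_of_real t \<in> spectrum_op A \<and> poly q t = 0"
proof -
  let ?q = "map_poly complex_of_real q"
  have "\<not> bounded_below (cpoly_apply ?q A)"
    using nb by (simp add: cpoly_apply_of_real)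
  moreover have "?q \<noteq> 0" using q by (simp add: map_poly_eq_0_iff)
  ultimately obtain z where root: "poly ?q z = 0"
    and z: "\<not> bounded_below (\<lambda>x. blinfun_apply A x - z *\<^sub>C x)"
    using bounded_below_cpoly_apply[OF selfadjoint_opD(1)[OF A]] by blast
  have "Im z = 0" using selfadjoint_bounded_below_nonreal[OF A] z by blast
  then obtain t where t: "z = complex_of_real t" by (metis complex_is_Real_iff Reals_cases)
  have "poly ?q (complex_of_real t) = complex_of_real (poly q t)"
    by (induction q) (simp_all add: map_poly_pCons)
  with root t have "poly q t = 0" by simp
  with not_bounded_below_imp_spectrum[OF z] t show ?thesis by blast
qed

text \<open>
  If \<open>\<parallel>B x\<parallel>\<close> is nearly \<open>\<parallel>B\<parallel> \<parallel>x\<parallel>\<close>, then \<open>B\<^sup>2 x\<close> is nearly \<open>\<parallel>B\<parallel>\<^sup>2 x\<close>, because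
  \<open>\<parallel>B\<^sup>2 x - l\<^sup>2 x\<parallel>\<^sup>2 = \<parallel>B\<^sup>2 x\<parallel>\<^sup>2 - 2 l\<^sup>2 \<parallel>B x\<parallel>\<^sup>2 + l\<^sup>4 \<parallel>x\<parallel>\<^sup>2 \<le> l\<^sup>2 (l\<^sup>2 \<parallel>x\<parallel>\<^sup>2 - \<parallel>B x\<parallel>\<^sup>2)\<close> with \<open>l = \<parallel>B\<parallel>\<close>.
  A lower bound \<open>c\<close> would thus improve the operator norm to \<open>m < l\<close>.
\<close>
lemma selfadjoint_norm_not_bounded_below:
  assumes B: "selfadjoint_op B" and nontrivial: "\<exists>x::'a::chilbert_space. x \<noteq> 0"
  shows "\<not> bounded_below (\<lambda>x::'a. blinfun_apply B (blinfun_apply B x) - (norm B)\<^sup>2 *\<^sub>R x)"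
proof
  define l where "l = norm B"
  assume "bounded_below (\<lambda>x::'a. blinfun_apply B (blinfun_apply B x) - (norm B)\<^sup>2 *\<^sub>R x)"
  then obtain c where c: "c > 0"
      "\<And>x::'a. c * norm x \<le> norm (blinfun_apply B (blinfun_apply B x) - l\<^sup>2 *\<^sub>R x)"
    unfolding bounded_below_def l_def by blast
  have key: "l\<^sup>2 * (norm (blinfun_apply B x))\<^sup>2 \<le> (l ^ 4 - c\<^sup>2) * (norm x)\<^sup>2" for x
  proof -
    have "(norm (blinfun_apply B (blinfun_apply B x)))\<^sup>2 \<le> (l * norm (blinfun_apply B x))\<^sup>2"
      unfolding l_def by (intro power_mono norm_blinfun) simp
    moreover have "cinner (blinfun_apply B (blinfun_apply B x)) x = cinner (blinfun_apply B x) (blinfun_apply B x)"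
      by (rule selfadjoint_opD(2)[OF B])
    then have "(norm (blinfun_apply B (blinfun_apply B x) - l\<^sup>2 *\<^sub>R x))\<^sup>2 =
        (norm (blinfun_apply B (blinfun_apply B x)))\<^sup>2 - 2 * (l\<^sup>2 * (norm (blinfun_apply B x))\<^sup>2) + l ^ 4 * (norm x)\<^sup>2"
      unfolding norm_diff_square by (simp add: cinner.scaleR_right Re_cinner_self power_mult_distrib)
    moreover have "(c * norm x)\<^sup>2 \<le> (norm (blinfun_apply B (blinfun_apply B x) - l\<^sup>2 *\<^sub>R x))\<^sup>2"
      using c by (intro power_mono) simp_all
    ultimately show ?thesis by (simp add: power_mult_distrib left_diff_distrib)
  qed
  obtain x0 :: 'a where x0: "x0 \<noteq> 0" using nontrivial by blast
  have "0 \<le> (l ^ 4 - c\<^sup>2) * (norm x0)\<^sup>2"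
    by (rule order_trans[OF _ key]) simp
  then have lc: "0 \<le> l ^ 4 - c\<^sup>2" using x0 by (simp add: zero_le_mult_iff)
  then have "l \<noteq> 0" using c(1) by auto
  then have l: "l > 0" by (simp add: l_def)
  define m where "m = sqrt ((l ^ 4 - c\<^sup>2) / l\<^sup>2)"
  have "norm (blinfun_apply B x) \<le> m * norm x" for x
  proof (rule power2_le_imp_le)
    show "(norm (blinfun_apply B x))\<^sup>2 \<le> (m * norm x)\<^sup>2"
      using key[of x] l lc by (simp add: m_def power_mult_distrib field_simps)
  qed (use lc in \<open>simp add: m_def\<close>)
  then have "l \<le> m" unfolding l_def using lc by (intro norm_blinfun_bound) (simp_all add: m_def)
  then have "l\<^sup>2 \<le> (l ^ 4 - c\<^sup>2) / l\<^sup>2"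
    using l lc unfolding m_def by (metis real_le_rsqrt real_sqrt_le_iff real_sqrt_abs abs_of_pos)
  then show False using l c(1) by (simp add: pos_le_divide_eq flip: power_add)
qed

text \<open>
  With \<open>l = \<parallel>p(A)\<parallel>\<close>, the operator \<open>p(A)\<^sup>2 - l\<^sup>2\<close> is not bounded below, and therefore \<open>p\<^sup>2 - l\<^sup>2\<close>
  has a root in the spectrum of \<open>A\<close>, unless it is the zero polynomial.
\<close>
lemma spectrum_attains_norm:
  fixes A :: "'a::chilbert_space \<Rightarrow>\<^sub>L 'a"
  assumes A: "selfadjoint_op A" and nontrivial: "\<exists>x::'a. x \<noteq> 0"
  shows "\<exists>t. complex_of_real t \<in> spectrum_op A \<and> \<bar>poly p t\<bar> = norm (poly_op p A)"
proof -
  have *: "\<exists>t. complex_of_real t \<in> spectrum_op A \<and> \<bar>poly p t\<bar> = norm (poly_op p A)"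
    if nz: "p * p - [:(norm (poly_op p A))\<^sup>2:] \<noteq> 0" for p
  proof -
    let ?l = "norm (poly_op p A)"
    have "blinfun_apply (poly_op (p * p - [:?l\<^sup>2:]) A) =
        (\<lambda>x. blinfun_apply (poly_op p A) (blinfun_apply (poly_op p A) x) - ?l\<^sup>2 *\<^sub>R x)"
      by (simp add: fun_eq_iff poly_op_diff poly_op_mult blinfun.diff_left blinfun.scaleR_left)
    then have "\<not> bounded_below (blinfun_apply (poly_op (p * p - [:?l\<^sup>2:]) A))"
      using selfadjoint_norm_not_bounded_below[OF selfadjoint_poly_op[OF A] nontrivial, of p] by simp
    then obtain t where "complex_of_real t \<in> spectrum_op A" "poly (p * p - [:?l\<^sup>2:]) t = 0"
      using poly_op_not_bounded_below_imp_root[OF A nz] by blast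
    moreover from this have "(poly p t)\<^sup>2 = ?l\<^sup>2" by (simp add: power2_eq_square)
    then have "\<bar>poly p t\<bar> = ?l" by (metis abs_norm_cancel power2_eq_iff abs_minus_cancel)
    ultimately show ?thesis by blast
  qed
  show ?thesis
  proof (cases "p * p - [:(norm (poly_op p A))\<^sup>2:] = 0")
    case True
    \<comment> \<open>Then every spectral value will do, and there is one by the case of the polynomial \<open>t\<close>.\<close>
    obtain t where t: "complex_of_real t \<in> spectrum_op A"
      using *[of "[:0, 1:]"] by auto
    have "poly (p * p - [:(norm (poly_op p A))\<^sup>2:]) t = 0" using True by simp
    then have "(poly p t)\<^sup>2 = (norm (poly_op p A))\<^sup>2" by (simp add: power2_eq_square)
    then have "\<bar>poly p t\<bar> = norm (poly_op p A)" by (metis abs_norm_cancel power2_eq_iff abs_minus_cancel)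
    with t show ?thesis by blast
  qed (rule *)
qed

lemma norm_poly_op_le:
  assumes A: "selfadjoint_op A" and C: "C \<ge> 0"
    and bound: "\<And>t. complex_of_real t \<in> spectrum_op A \<Longrightarrow> \<bar>poly p t\<bar> \<le> C"
  shows "norm (poly_op p A) \<le> C"
proof (cases "\<exists>x::'a. x \<noteq> 0")
  case True
  then show ?thesis using spectrum_attains_norm[OF A True, of p] bound by metis
next
  case False
  then have "poly_op p A = 0" by (intro blinfun_eqI) metis
  then show ?thesis using C by simp
qed

section \<open>Continuous functional calculus of a positive operator\<close>

text \<open>
  With \<open>q = p\<close> this makes \<open>p\<^sub>n(A)\<close> a Cauchy sequence; with two different sequences it shows that
  the limit does not depend on the choice of polynomials.
\<close>
lemma poly_op_uniform_limit_diff: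
  assumes A: "selfadjoint_op A"
    and p: "uniform_limit {t. complex_of_real t \<in> spectrum_op A} (\<lambda>n. poly (p n)) h sequentially"
    and q: "uniform_limit {t. complex_of_real t \<in> spectrum_op A} (\<lambda>n. poly (q n)) h sequentially"
    and e: "e > 0"
  shows "\<exists>N. \<forall>m\<ge>N. \<forall>n\<ge>N. norm (poly_op (p m) A - poly_op (q n) A) \<le> e"
proof -
  let ?S = "{t. complex_of_real t \<in> spectrum_op A}"
  have "\<forall>\<^sub>F n in sequentially. \<forall>t\<in>?S. dist (poly (p n) t) (h t) < e / 2 \<and> dist (poly (q n) t) (h t) < e / 2"
    using uniform_limitD[OF p half_gt_zero[OF e]] uniform_limitD[OF q half_gt_zero[OF e]]
    by eventually_elim blast
  then obtain N where N: "\<And>n t. n \<ge> N \<Longrightarrow> t \<in> ?S \<Longrightarrow>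
      dist (poly (p n) t) (h t) < e / 2 \<and> dist (poly (q n) t) (h t) < e / 2"
    unfolding eventually_sequentially by blast
  have "norm (poly_op (p m) A - poly_op (q n) A) \<le> e" if "m \<ge> N" "n \<ge> N" for m n
    unfolding poly_op_diff[symmetric]
  proof (rule norm_poly_op_le[OF A])
    fix t assume "complex_of_real t \<in> spectrum_op A"
    then have "dist (poly (p m) t) (h t) < e / 2" "dist (poly (q n) t) (h t) < e / 2"
      using N that by auto
    then have "dist (poly (p m) t) (poly (q n) t) < e" by (rule dist_triangle_half_l)
    then show "\<bar>poly (p m - q n) t\<bar> \<le> e" by (simp add: dist_real_def)
  qed (use e in simp)
  then show ?thesis by blast
qed

text \<open>
  This is the only access to the description in the definition of \<open>cfc\<close>: its algebraic
  rules, from which the other properties follow, are limits of those for polynomials.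
\<close>
lemma cfc_tendsto:
  assumes A: "positive_op A"
    and p: "uniform_limit {0..norm A} (\<lambda>n. poly (p n)) h sequentially"
  shows "(\<lambda>n. poly_op (p n) A) \<longlonglongrightarrow> cfc A h"
proof -
  let ?S = "{t. complex_of_real t \<in> spectrum_op A}"
  note sa = positive_op_selfadjoint[OF A]
  have pS: "uniform_limit ?S (\<lambda>n. poly (p n)) h sequentially"
    by (rule uniform_limit_on_subset[OF p]) (use positive_op_spectrum[OF A] in blast)
  have "Cauchy (\<lambda>n. poly_op (p n) A)"
  proof (rule metric_CauchyI)
    fix e :: real assume "e > 0"
    then obtain N where "\<forall>m\<ge>N. \<forall>n\<ge>N. norm (poly_op (p m) A - poly_op (p n) A) \<le> e / 2"
      using poly_op_uniform_limit_diff[OF sa pS pS, of "e / 2"] by auto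
    with \<open>e > 0\<close> show "\<exists>M. \<forall>m\<ge>M. \<forall>n\<ge>M. dist (poly_op (p m) A) (poly_op (p n) A) < e"
      by (intro exI[of _ N]) (fastforce simp: dist_norm)
  qed
  then obtain B where B: "(\<lambda>n. poly_op (p n) A) \<longlonglongrightarrow> B"
    using Cauchy_convergent_iff convergent_def by blast
  have "cfc A h = B"
    unfolding cfc_def
  proof (rule the_equality)
    fix C assume "\<exists>q. uniform_limit ?S (\<lambda>n. poly (q n)) h sequentially \<and> (\<lambda>n. poly_op (q n) A) \<longlonglongrightarrow> C"
    then obtain q where q: "uniform_limit ?S (\<lambda>n. poly (q n)) h sequentially"
      and C: "(\<lambda>n. poly_op (q n) A) \<longlonglongrightarrow> C" by blast
    have "(\<lambda>n. poly_op (q n) A - poly_op (p n) A) \<longlonglongrightarrow> 0"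
    proof (rule LIMSEQ_I)
      fix e :: real assume "e > 0"
      then obtain N where "\<forall>m\<ge>N. \<forall>n\<ge>N. norm (poly_op (q m) A - poly_op (p n) A) \<le> e / 2"
        using poly_op_uniform_limit_diff[OF sa q pS, of "e / 2"] by auto
      with \<open>e > 0\<close> show "\<exists>N. \<forall>n\<ge>N. norm (poly_op (q n) A - poly_op (p n) A - 0) < e"
        by (intro exI[of _ N]) fastforce
    qed
    moreover have "(\<lambda>n. poly_op (q n) A - poly_op (p n) A) \<longlonglongrightarrow> C - B"
      by (intro tendsto_diff B C)
    ultimately show "C = B" using LIMSEQ_unique by fastforce
  qed (use pS B in blast)
  with B show ?thesis by simp
qed

lemma weierstrass_real_poly:
  fixes h :: "real \<Rightarrow> real"
  assumes "continuous_on {a..b} h"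
  shows "\<exists>p. uniform_limit {a..b} (\<lambda>n. poly (p n)) h sequentially"
proof -
  obtain g where g: "uniform_limit {a..b} g h sequentially" "\<And>n. polynomial_function (g n)"
    using Stone_Weierstrass_uniform_limit[OF compact_Icc assms] by blast
  have "\<exists>p. g n = poly p" for n
  proof -
    have "real_polynomial_function (g n)" using g(2) by (simp add: real_polynomial_function_eq)
    then obtain a m where "g n = (\<lambda>x. \<Sum>i\<le>m. a i * x ^ i)"
      using real_polynomial_function_imp_sum by blast
    then have "g n = poly (\<Sum>i\<le>m. monom (a i) i)"
      by (simp add: fun_eq_iff poly_sum poly_monom)
    then show ?thesis by blast
  qed
  then obtain p where "\<And>n. g n = poly (p n)" by metis
  then have "g = (\<lambda>n. poly (p n))" by blast
  with g(1) show ?thesis by blast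
qed

lemma cfc_approx:
  assumes A: "positive_op A" and h: "continuous_on {0..} h"
  obtains p where "uniform_limit {0..norm A} (\<lambda>n. poly (p n)) h sequentially"
    and "(\<lambda>n. poly_op (p n) A) \<longlonglongrightarrow> cfc A h"
proof -
  have "continuous_on {0..norm A} h" by (rule continuous_on_subset[OF h]) auto
  then show thesis using weierstrass_real_poly cfc_tendsto[OF A] that by blast
qed

lemma cfc_poly:
  assumes "positive_op A"
  shows "cfc A (poly p) = poly_op p A"
proof -
  have "uniform_limit {0..norm A} (\<lambda>n::nat. poly p) (poly p) sequentially"
    by (rule uniform_limitI) simp
  then have "(\<lambda>n::nat. poly_op p A) \<longlonglongrightarrow> cfc A (poly p)" by (rule cfc_tendsto[OF assms])
  then show ?thesis using LIMSEQ_unique[OF tendsto_const] by metis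
qed

lemma continuous_on_bounded_image:
  fixes h :: "real \<Rightarrow> real"
  assumes "continuous_on {0..} h"
  shows "bounded (h ` {0..b})"
proof -
  have "continuous_on {0..b} h" by (rule continuous_on_subset[OF assms]) auto
  then show ?thesis by (intro compact_imp_bounded compact_continuous_image compact_Icc)
qed

lemma cfc_cong:
  assumes A: "positive_op A" and h: "continuous_on {0..} h"
    and eq: "\<And>t. t \<ge> 0 \<Longrightarrow> h t = k t"
  shows "cfc A h = cfc A k"
proof -
  obtain p where p: "uniform_limit {0..norm A} (\<lambda>n. poly (p n)) h sequentially"
    and lim: "(\<lambda>n. poly_op (p n) A) \<longlonglongrightarrow> cfc A h"
    using cfc_approx[OF A h] by blast
  have "uniform_limit {0..norm A} (\<lambda>n. poly (p n)) k sequentially"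
    using p eq uniform_limit_cong'[of "{0..norm A}" "\<lambda>n. poly (p n)" "\<lambda>n. poly (p n)" h k]
    by auto
  then show ?thesis using cfc_tendsto[OF A] LIMSEQ_unique[OF lim] by blast
qed

lemma cfc_const:
  assumes "positive_op A"
  shows "cfc A (\<lambda>t. c) = c *\<^sub>R id_blinfun"
proof -
  have "(\<lambda>t. c) = poly [:c:]" by (simp add: fun_eq_iff)
  then show ?thesis by (simp add: cfc_poly[OF assms])
qed

lemma cfc_ident:
  assumes "positive_op A"
  shows "cfc A (\<lambda>t. t) = A"
proof -
  have "(\<lambda>t::real. t) = poly [:0, 1:]" by (simp add: fun_eq_iff)
  then show ?thesis by (intro blinfun_eqI) (simp add: cfc_poly[OF assms])
qed

lemma cfc_diff:
  assumes A: "positive_op A" and h: "continuous_on {0..} h" and k: "continuous_on {0..} k"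
  shows "cfc A (\<lambda>t. h t - k t) = cfc A h - cfc A k"
proof -
  obtain p where p: "uniform_limit {0..norm A} (\<lambda>n. poly (p n)) h sequentially"
    and plim: "(\<lambda>n. poly_op (p n) A) \<longlonglongrightarrow> cfc A h" using cfc_approx[OF A h] by blast
  obtain q where q: "uniform_limit {0..norm A} (\<lambda>n. poly (q n)) k sequentially"
    and qlim: "(\<lambda>n. poly_op (q n) A) \<longlonglongrightarrow> cfc A k" using cfc_approx[OF A k] by blast
  have "poly (p n - q n) = (\<lambda>t. poly (p n) t - poly (q n) t)" for n by (simp add: fun_eq_iff)
  then have "uniform_limit {0..norm A} (\<lambda>n. poly (p n - q n)) (\<lambda>t. h t - k t) sequentially"
    using uniform_limit_minus[OF p q] by simp
  then have "(\<lambda>n. poly_op (p n - q n) A) \<longlonglongrightarrow> cfc A (\<lambda>t. h t - k t)" by (rule cfc_tendsto[OF A])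
  moreover have "(\<lambda>n. poly_op (p n - q n) A) \<longlonglongrightarrow> cfc A h - cfc A k"
    unfolding poly_op_diff by (intro tendsto_diff plim qlim)
  ultimately show ?thesis by (rule LIMSEQ_unique)
qed

lemma cfc_mult:
  assumes A: "positive_op A" and h: "continuous_on {0..} h" and k: "continuous_on {0..} k"
  shows "cfc A (\<lambda>t. h t * k t) = cfc A h o\<^sub>L cfc A k"
proof -
  obtain p where p: "uniform_limit {0..norm A} (\<lambda>n. poly (p n)) h sequentially"
    and plim: "(\<lambda>n. poly_op (p n) A) \<longlonglongrightarrow> cfc A h" using cfc_approx[OF A h] by blast
  obtain q where q: "uniform_limit {0..norm A} (\<lambda>n. poly (q n)) k sequentially"
    and qlim: "(\<lambda>n. poly_op (q n) A) \<longlonglongrightarrow> cfc A k" using cfc_approx[OF A k] by blast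
  have "poly (p n * q n) = (\<lambda>t. poly (p n) t * poly (q n) t)" for n by (simp add: fun_eq_iff)
  moreover have "uniform_limit {0..norm A} (\<lambda>n t. poly (p n) t * poly (q n) t) (\<lambda>t. h t * k t) sequentially"
    by (intro uniform_lim_mult p q continuous_on_bounded_image h k)
  ultimately have "uniform_limit {0..norm A} (\<lambda>n. poly (p n * q n)) (\<lambda>t. h t * k t) sequentially"
    by simp
  then have "(\<lambda>n. poly_op (p n * q n) A) \<longlonglongrightarrow> cfc A (\<lambda>t. h t * k t)" by (rule cfc_tendsto[OF A])
  moreover have "(\<lambda>n. poly_op (p n * q n) A) \<longlonglongrightarrow> (cfc A h o\<^sub>L cfc A k)"
    unfolding poly_op_mult
    by (intro bounded_bilinear.tendsto[OF bounded_bilinear_blinfun_compose] plim qlim)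
  ultimately show ?thesis by (rule LIMSEQ_unique)
qed

lemma cfc_mult_apply:
  assumes "positive_op A" "continuous_on {0..} h" "continuous_on {0..} k"
  shows "blinfun_apply (cfc A h) (blinfun_apply (cfc A k) x) = blinfun_apply (cfc A (\<lambda>t. h t * k t)) x"
  by (simp add: cfc_mult[OF assms])

lemma cfc_apply_tendsto:
  "(\<lambda>n. poly_op (p n) A) \<longlonglongrightarrow> B \<Longrightarrow> (\<lambda>n. blinfun_apply (poly_op (p n) A) x) \<longlonglongrightarrow> blinfun_apply B x"
  by (intro blinfun.tendsto tendsto_const)

lemma selfadjoint_cfc:
  assumes A: "positive_op A" and h: "continuous_on {0..} h"
  shows "selfadjoint_op (cfc A h)"
proof -
  obtain p where "(\<lambda>n. poly_op (p n) A) \<longlonglongrightarrow> cfc A h"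
    using cfc_approx[OF A h] by blast
  note lim = cfc_apply_tendsto[OF this]
  note sa = selfadjoint_opD[OF selfadjoint_poly_op[OF positive_op_selfadjoint[OF A]]]
  have "blinfun_apply (cfc A h) (c *\<^sub>C x) = c *\<^sub>C blinfun_apply (cfc A h) x" for c x
  proof (rule LIMSEQ_unique[OF lim])
    show "(\<lambda>n. blinfun_apply (poly_op (p n) A) (c *\<^sub>C x)) \<longlonglongrightarrow> c *\<^sub>C blinfun_apply (cfc A h) x"
      unfolding bounded_opsD[OF sa(1)] by (intro scaleC.tendsto tendsto_const lim)
  qed
  moreover have "cinner (blinfun_apply (cfc A h) x) y = cinner x (blinfun_apply (cfc A h) y)" for x y
  proof (rule LIMSEQ_unique)
    show "(\<lambda>n. cinner (blinfun_apply (poly_op (p n) A) x) y) \<longlonglongrightarrow> cinner (blinfun_apply (cfc A h) x) y"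
      by (intro cinner.tendsto tendsto_const lim)
    show "(\<lambda>n. cinner (blinfun_apply (poly_op (p n) A) x) y) \<longlonglongrightarrow> cinner x (blinfun_apply (cfc A h) y)"
      unfolding sa(2) by (intro cinner.tendsto tendsto_const lim)
  qed
  ultimately show ?thesis by (simp add: selfadjoint_op_def bounded_ops_def)
qed

lemma norm_cfc_square:
  assumes A: "positive_op A" and h: "continuous_on {0..} h"
  shows "(norm (blinfun_apply (cfc A h) x))\<^sup>2 = Re (cinner (blinfun_apply (cfc A (\<lambda>t. h t * h t)) x) x)"
  by (simp add: cfc_mult[OF A h h] selfadjoint_opD(2)[OF selfadjoint_cfc[OF A h]] flip: Re_cinner_self)

text \<open>
  A nonnegative \<open>h\<close> is the square of \<open>\<surd>h\<close>, hence \<open>\<langle>h(A) x, x\<rangle> = \<parallel>(\<surd>h)(A) x\<parallel>\<^sup>2\<close>.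
\<close>
lemma cfc_form_nonneg:
  assumes A: "positive_op A" and h: "continuous_on {0..} h"
    and nonneg: "\<And>t. t \<ge> 0 \<Longrightarrow> h t \<ge> 0"
  shows "0 \<le> Re (cinner (blinfun_apply (cfc A h) x) x)"
proof -
  have s: "continuous_on {0..} (\<lambda>t. sqrt (h t))" by (intro continuous_intros h)
  have "cfc A h = cfc A (\<lambda>t. sqrt (h t) * sqrt (h t))"
    by (rule cfc_cong[OF A h]) (simp add: nonneg)
  then show ?thesis using norm_cfc_square[OF A s, of x] by (metis zero_le_power2)
qed

lemma cfc_form_mono:
  assumes A: "positive_op A" and h: "continuous_on {0..} h" and k: "continuous_on {0..} k"
    and le: "\<And>t. t \<ge> 0 \<Longrightarrow> h t \<le> k t"
  shows "Re (cinner (blinfun_apply (cfc A h) x) x) \<le> Re (cinner (blinfun_apply (cfc A k) x) x)"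
proof -
  have "0 \<le> Re (cinner (blinfun_apply (cfc A (\<lambda>t. k t - h t)) x) x)"
    by (intro cfc_form_nonneg A continuous_intros h k) (simp add: le)
  then show ?thesis by (simp add: cfc_diff[OF A k h] blinfun.diff_left cinner.diff_left)
qed

lemma norm_cfc_apply_le:
  assumes A: "positive_op A" and h: "continuous_on {0..} h"
    and bound: "\<And>t. t \<ge> 0 \<Longrightarrow> \<bar>h t\<bar> \<le> C"
  shows "norm (blinfun_apply (cfc A h) x) \<le> C * norm x"
proof (rule power2_le_imp_le)
  have C: "C \<ge> 0" using bound[of 0] by simp
  then show "0 \<le> C * norm x" by simp
  have "h t * h t \<le> C\<^sup>2" if "t \<ge> 0" for t
    using bound[OF that] C by (metis abs_le_square_iff abs_of_nonneg power2_eq_square)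
  then have "(norm (blinfun_apply (cfc A h) x))\<^sup>2 \<le> Re (cinner (blinfun_apply (cfc A (\<lambda>t. C\<^sup>2)) x) x)"
    unfolding norm_cfc_square[OF A h] by (intro cfc_form_mono A continuous_intros h)
  also have "\<dots> = (C * norm x)\<^sup>2"
    by (simp add: cfc_const[OF A] blinfun.scaleR_left cinner.scaleR_left Re_cinner_self power_mult_distrib)
  finally show "(norm (blinfun_apply (cfc A h) x))\<^sup>2 \<le> (C * norm x)\<^sup>2" .
qed

text \<open>
  Clear for polynomials; the same polynomials can serve \<open>S\<close> and \<open>T\<close> if they approximate \<open>h\<close> on the
  larger of the two intervals.
\<close>
lemma cfc_intertwine:
  assumes S: "positive_op S" and T: "positive_op T" and h: "continuous_on {0..} h"
    and X: "\<And>x. blinfun_apply X (blinfun_apply S x) = blinfun_apply T (blinfun_apply X x)"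
  shows "blinfun_apply X (blinfun_apply (cfc S h) x) = blinfun_apply (cfc T h) (blinfun_apply X x)"
proof -
  define M where "M = max (norm S) (norm T)"
  have "continuous_on {0..M} h" by (rule continuous_on_subset[OF h]) auto
  then obtain p where p: "uniform_limit {0..M} (\<lambda>n. poly (p n)) h sequentially"
    using weierstrass_real_poly by blast
  have "uniform_limit {0..norm S} (\<lambda>n. poly (p n)) h sequentially"
    "uniform_limit {0..norm T} (\<lambda>n. poly (p n)) h sequentially"
    by (rule uniform_limit_on_subset[OF p]; simp add: M_def)+
  note lim = cfc_apply_tendsto[OF cfc_tendsto[OF S this(1)]] cfc_apply_tendsto[OF cfc_tendsto[OF T this(2)]]
  have inter: "blinfun_apply X (blinfun_apply (poly_op q S) x) = blinfun_apply (poly_op q T) (blinfun_apply X x)"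
    for q x
    by (induction q) (simp_all add: blinfun.add_left blinfun.add_right blinfun.scaleR_left
        blinfun.scaleR_right blinfun.zero_left blinfun.zero_right X)
  show ?thesis
  proof (rule LIMSEQ_unique)
    show "(\<lambda>n. blinfun_apply X (blinfun_apply (poly_op (p n) S) x)) \<longlonglongrightarrow>
        blinfun_apply X (blinfun_apply (cfc S h) x)"
      by (intro blinfun.tendsto tendsto_const lim)
    show "(\<lambda>n. blinfun_apply X (blinfun_apply (poly_op (p n) S) x)) \<longlonglongrightarrow>
        blinfun_apply (cfc T h) (blinfun_apply X x)"
      unfolding inter by (rule lim)
  qed
qed

section \<open>Square roots and absolute values\<close>

text \<open>
  If \<open>p\<^sub>n\<close> approximates \<open>h\<close>, then \<open>p\<^sub>n(t\<^sup>2)\<close> approximates \<open>h(t\<^sup>2)\<close>, and \<open>p\<^sub>n(B\<^sup>2)\<close> is a polynomial of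
  \<open>B\<close>. This yields the uniqueness of positive square roots.
\<close>
lemma cfc_compose_square:
  assumes B: "positive_op B" and BB: "positive_op (B o\<^sub>L B)" and h: "continuous_on {0..} h"
  shows "cfc (B o\<^sub>L B) h = cfc B (\<lambda>t. h (t\<^sup>2))"
proof -
  have "continuous_on {0..(norm B)\<^sup>2} h" by (rule continuous_on_subset[OF h]) auto
  then obtain p where p: "uniform_limit {0..(norm B)\<^sup>2} (\<lambda>n. poly (p n)) h sequentially"
    using weierstrass_real_poly by blast
  have "norm (B o\<^sub>L B) \<le> (norm B)\<^sup>2"
    using norm_blinfun_compose[of B B] by (simp add: power2_eq_square)
  then have "uniform_limit {0..norm (B o\<^sub>L B)} (\<lambda>n. poly (p n)) h sequentially"
    by (intro uniform_limit_on_subset[OF p]) auto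
  then have lim: "(\<lambda>n. poly_op (p n) (B o\<^sub>L B)) \<longlonglongrightarrow> cfc (B o\<^sub>L B) h"
    by (rule cfc_tendsto[OF BB])
  define s :: "real poly" where "s = [:0, 0, 1:]"
  have s: "poly s t = t\<^sup>2" for t by (simp add: s_def power2_eq_square)
  have "poly_op s B = B o\<^sub>L B"
    by (intro blinfun_eqI) (simp add: s_def blinfun.add_left blinfun.add_right blinfun.zero_left
        blinfun.zero_right)
  then have eq: "poly_op (p n \<circ>\<^sub>p s) B = poly_op (p n) (B o\<^sub>L B)" for n
    by (simp add: poly_op_pcompose)
  have "poly (p n \<circ>\<^sub>p s) = (\<lambda>t. poly (p n) (t\<^sup>2))" for n by (simp add: fun_eq_iff poly_pcompose s)
  moreover have "uniform_limit {0..norm B} (\<lambda>n t. poly (p n) (t\<^sup>2)) (\<lambda>t. h (t\<^sup>2)) sequentially"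
    by (rule uniform_limit_compose'[OF p]) (auto intro: power_mono)
  ultimately have "uniform_limit {0..norm B} (\<lambda>n. poly (p n \<circ>\<^sub>p s)) (\<lambda>t. h (t\<^sup>2)) sequentially"
    by simp
  then have "(\<lambda>n. poly_op (p n \<circ>\<^sub>p s) B) \<longlonglongrightarrow> cfc B (\<lambda>t. h (t\<^sup>2))" by (rule cfc_tendsto[OF B])
  then show ?thesis unfolding eq using LIMSEQ_unique[OF lim] by blast
qed

text \<open>
  Existence is the calculus applied to \<open>\<surd>t\<close>. For uniqueness, a positive \<open>B\<close> with \<open>B\<^sup>2 = T\<close> satisfies
  \<open>(\<surd>t)(T) = (\<surd>(t\<^sup>2))(B) = B\<close>.
\<close>
lemma
  assumes T: "positive_op T"
  shows sqrt_op_cfc: "sqrt_op T = cfc T sqrt"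
    and positive_sqrt_op: "positive_op (sqrt_op T)"
    and sqrt_op_square: "sqrt_op T o\<^sub>L sqrt_op T = T"
proof -
  have c: "continuous_on {0..} sqrt" by (intro continuous_intros)
  have pos: "positive_op (cfc T sqrt)"
    unfolding positive_op_def
  proof (intro conjI allI)
    note sa = selfadjoint_opD[OF selfadjoint_cfc[OF T c]]
    show "cfc T sqrt \<in> bounded_ops" by (rule sa(1))
    fix x
    show "cinner (blinfun_apply (cfc T sqrt) x) x \<in> \<real>"
      unfolding Reals_cnj_iff by (metis sa(2) cinner_commute)
    show "0 \<le> Re (cinner (blinfun_apply (cfc T sqrt) x) x)" by (rule cfc_form_nonneg[OF T c]) simp
  qed
  have "cfc T sqrt o\<^sub>L cfc T sqrt = cfc T (\<lambda>t. sqrt t * sqrt t)" by (rule cfc_mult[OF T c c, symmetric])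
  also have "\<dots> = cfc T (\<lambda>t. t)" by (rule cfc_cong[OF T]) (auto intro!: continuous_intros)
  finally have square: "cfc T sqrt o\<^sub>L cfc T sqrt = T" by (simp add: cfc_ident[OF T])
  show eq: "sqrt_op T = cfc T sqrt"
    unfolding sqrt_op_def
  proof (rule the_equality)
    show "positive_op (cfc T sqrt) \<and> cfc T sqrt o\<^sub>L cfc T sqrt = T" using pos square ..
    fix B assume B: "positive_op B \<and> B o\<^sub>L B = T"
    have "cfc T sqrt = cfc B (\<lambda>t. sqrt (t\<^sup>2))"
      using cfc_compose_square[of B sqrt] B T c by simp
    also have "\<dots> = cfc B (\<lambda>t. t)"
      using B by (intro cfc_cong) (auto intro!: continuous_intros)
    finally show "B = cfc T sqrt" using B by (simp add: cfc_ident)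
  qed
  show "positive_op (sqrt_op T)" "sqrt_op T o\<^sub>L sqrt_op T = T"
    unfolding eq by (rule pos, rule square)
qed

lemma positive_adj_compose:
  assumes X: "X \<in> bounded_ops"
  shows "positive_op (adj X o\<^sub>L X)"
  by (simp add: positive_op_def compose_bounded_ops adj_bounded_ops X cinner_adj_left cinner_self)

lemma positive_abs_op: "X \<in> bounded_ops \<Longrightarrow> positive_op (abs_op X)"
  unfolding abs_op_def by (intro positive_sqrt_op positive_adj_compose)

lemma norm_abs_op_apply:
  assumes X: "X \<in> bounded_ops"
  shows "norm (blinfun_apply (abs_op X) x) = norm (blinfun_apply X x)"
proof -
  let ?P = "abs_op X"
  have "cinner (blinfun_apply ?P x) (blinfun_apply ?P x) = cinner (blinfun_apply (?P o\<^sub>L ?P) x) x"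
    by (simp add: selfadjoint_opD(2)[OF positive_op_selfadjoint[OF positive_abs_op[OF X]]])
  also have "?P o\<^sub>L ?P = adj X o\<^sub>L X"
    unfolding abs_op_def by (rule sqrt_op_square[OF positive_adj_compose[OF X]])
  also have "cinner (blinfun_apply (adj X o\<^sub>L X) x) x = cinner (blinfun_apply X x) (blinfun_apply X x)"
    by (simp add: cinner_adj_left[OF X])
  finally have "(norm (blinfun_apply ?P x))\<^sup>2 = (norm (blinfun_apply X x))\<^sup>2"
    by (metis Re_cinner_self)
  then show ?thesis by simp
qed

text \<open>
  From \<open>X (X\<^sup>* X) = (X X\<^sup>* ) X\<close> the function \<open>\<surd>t\<close> gives \<open>X \<bar>X\<bar> = \<bar>X\<^sup>*\<bar> X\<close>, and then \<open>h\<close> gives the claim.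
\<close>
lemma cfc_abs_op_intertwine:
  assumes X: "X \<in> bounded_ops" and h: "continuous_on {0..} h"
  shows "blinfun_apply X (blinfun_apply (cfc (abs_op X) h) x) =
    blinfun_apply (cfc (abs_op (adj X)) h) (blinfun_apply X x)"
proof (rule cfc_intertwine[OF _ _ h])
  note aX = adj_bounded_ops[OF X]
  show "positive_op (abs_op X)" "positive_op (abs_op (adj X))"
    using X aX by (simp_all add: positive_abs_op)
  show "blinfun_apply X (blinfun_apply (abs_op X) x) = blinfun_apply (abs_op (adj X)) (blinfun_apply X x)" for x
    unfolding abs_op_def sqrt_op_cfc[OF positive_adj_compose[OF X]]
      sqrt_op_cfc[OF positive_adj_compose[OF aX]]
    by (rule cfc_intertwine[OF positive_adj_compose[OF X] positive_adj_compose[OF aX]])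
      (simp_all add: adj_adj[OF X] continuous_on_real_sqrt)
qed

section \<open>The mixed Schwarz inequality\<close>

text \<open>
  Put \<open>P = \<bar>X\<bar>\<close>, \<open>Q = \<bar>X\<^sup>*\<bar>\<close> and \<open>k(t) = 1 / (t + d)\<close> with \<open>d > 0\<close>. As \<open>t k(t) = g(t) k(t) f(t)\<close>, the
  intertwining relation gives the factorisation \<open>X P k(P) = g(Q) (X k(P)) f(P)\<close>. The middle factor
  is a contraction, so the Cauchy--Schwarz inequality bounds the form of \<open>X P k(P)\<close> as claimed. This
  operator differs from \<open>X\<close> by at most \<open>d\<close> in norm. Here \<open>X k(P)\<close> takes the place of the partial
  isometry in the polar decomposition \<open>X = U P\<close>.
\<close>
lemma mixed_schwarz:
  assumes X: "X \<in> bounded_ops" and f: "continuous_on {0..} f" and g: "continuous_on {0..} g"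
    and fg: "\<And>t. t \<ge> 0 \<Longrightarrow> f t * g t = t"
  shows "cmod (cinner (blinfun_apply X x) y) \<le>
    norm (blinfun_apply (cfc (abs_op X) f) x) * norm (blinfun_apply (cfc (abs_op (adj X)) g) y)"
proof (rule field_le_epsilon)
  fix e :: real assume e: "e > 0"
  define P Q where "P = abs_op X" and "Q = abs_op (adj X)"
  have P: "positive_op P" and Q: "positive_op Q"
    by (simp_all add: P_def Q_def positive_abs_op X adj_bounded_ops)
  have n: "norm x * norm y + 1 > 0" by (simp add: add_nonneg_pos)
  \<comment> \<open>Added to the denominator: \<open>1\<close>, because \<open>x\<close> or \<open>y\<close> may be zero.\<close>
  define d where "d = e / (norm x * norm y + 1)"
  have d: "d > 0" using e n by (simp add: d_def)
  define k where "k t = 1 / (t + d)" for t :: real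
  have k: "continuous_on {0..} k" unfolding k_def by (intro continuous_intros) (use d in auto)
  have id: "continuous_on {0..} (\<lambda>t::real. t)" by (rule continuous_on_id)
  note cont = continuous_on_mult[OF k f] continuous_on_mult[OF id k]
  let ?kf = "blinfun_apply (cfc P (\<lambda>t. k t * f t)) x" and ?fx = "blinfun_apply (cfc P f) x"
  have XP: "norm (blinfun_apply X v) = norm (blinfun_apply P v)" for v
    by (simp add: P_def norm_abs_op_apply[OF X])
  have contr: "norm (blinfun_apply X ?kf) \<le> norm ?fx"
  proof -
    \<comment> \<open>\<open>X\<close> and \<open>P\<close> have the same norms at every vector, and \<open>0 \<le> t k(t) \<le> 1\<close>.\<close>
    have "norm (blinfun_apply X ?kf) = norm (blinfun_apply (cfc P (\<lambda>t. t)) (blinfun_apply (cfc P k) ?fx))"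
      by (simp add: XP cfc_ident[OF P] cfc_mult_apply[OF P k f])
    also have "\<dots> = norm (blinfun_apply (cfc P (\<lambda>t. t * k t)) ?fx)"
      by (simp add: cfc_mult_apply[OF P id k])
    also have "\<dots> \<le> 1 * norm ?fx"
      by (rule norm_cfc_apply_le[OF P cont(2)]) (use d in \<open>simp add: k_def field_simps\<close>)
    finally show ?thesis by simp
  qed
  let ?z = "blinfun_apply (cfc P (\<lambda>t. t * k t)) x"
  have "cfc P (\<lambda>t. t * k t) = cfc P (\<lambda>t. g t * (k t * f t))"
  proof (rule cfc_cong[OF P cont(2)])
    show "t * k t = g t * (k t * f t)" if "t \<ge> 0" for t
      using fg[OF that] by (metis mult.assoc mult.commute)
  qed
  then have "?z = blinfun_apply (cfc P g) ?kf"
    by (simp add: cfc_mult_apply[OF P g cont(1)])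
  then have "cinner (blinfun_apply X ?z) y = cinner (blinfun_apply (cfc Q g) (blinfun_apply X ?kf)) y"
    by (simp add: P_def Q_def cfc_abs_op_intertwine[OF X g])
  also have "\<dots> = cinner (blinfun_apply X ?kf) (blinfun_apply (cfc Q g) y)"
    by (rule selfadjoint_opD(2)[OF selfadjoint_cfc[OF Q g]])
  also have "cmod \<dots> \<le> norm (blinfun_apply X ?kf) * norm (blinfun_apply (cfc Q g) y)"
    by (rule cinner_cauchy_schwarz)
  also have "\<dots> \<le> norm ?fx * norm (blinfun_apply (cfc Q g) y)"
    by (intro mult_right_mono contr) simp
  finally have main: "cmod (cinner (blinfun_apply X ?z) y) \<le> norm ?fx * norm (blinfun_apply (cfc Q g) y)" .
  \<comment> \<open>Indeed \<open>t (1 - t k(t)) = d t / (t + d) \<le> d\<close>.\<close>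
  have "norm (blinfun_apply X x - blinfun_apply X ?z) \<le> d * norm x"
  proof -
    have c1: "continuous_on {0..} (\<lambda>t. 1 - t * k t)" by (intro continuous_intros cont(2))
    have "x - ?z = blinfun_apply (cfc P (\<lambda>t. 1 - t * k t)) x"
      by (simp add: cfc_diff[OF P continuous_on_const cont(2)] cfc_const[OF P] blinfun.diff_left)
    then have "norm (blinfun_apply X x - blinfun_apply X ?z) =
        norm (blinfun_apply (cfc P (\<lambda>t. t)) (blinfun_apply (cfc P (\<lambda>t. 1 - t * k t)) x))"
      by (simp add: XP cfc_ident[OF P] flip: blinfun.diff_right)
    also have "\<dots> = norm (blinfun_apply (cfc P (\<lambda>t. t * (1 - t * k t))) x)"
      by (simp only: cfc_mult_apply[OF P id c1])
    also have "\<dots> \<le> d * norm x"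
    proof (rule norm_cfc_apply_le[OF P])
      show "\<bar>t * (1 - t * k t)\<bar> \<le> d" if "t \<ge> 0" for t
      proof -
        have "t * (1 - t * k t) = d * (t * k t)" using that d by (simp add: k_def field_simps)
        then have "\<bar>t * (1 - t * k t)\<bar> = d * \<bar>t * k t\<bar>" using d by (simp only: abs_mult[of d] abs_of_pos)
        moreover have "\<bar>t * k t\<bar> \<le> 1" using that d by (simp add: k_def field_simps)
        ultimately show ?thesis using d by (simp add: mult_left_le)
      qed
    qed (intro continuous_intros c1)
    finally show ?thesis .
  qed
  then have "cmod (cinner (blinfun_apply X x - blinfun_apply X ?z) y) \<le> d * norm x * norm y"
    by (intro order_trans[OF cinner_cauchy_schwarz] mult_right_mono) simp_all
  also have "\<dots> \<le> e"
    using n e by (simp add: d_def field_simps)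
  finally have "cmod (cinner (blinfun_apply X x) y - cinner (blinfun_apply X ?z) y) \<le> e"
    by (simp add: cinner.diff_left)
  then have "cmod (cinner (blinfun_apply X x) y) \<le> cmod (cinner (blinfun_apply X ?z) y) + e"
    using norm_triangle_sub[of "cinner (blinfun_apply X x) y" "cinner (blinfun_apply X ?z) y"] by linarith
  with main show "cmod (cinner (blinfun_apply X x) y) \<le>
      norm (blinfun_apply (cfc (abs_op X) f) x) * norm (blinfun_apply (cfc (abs_op (adj X)) g) y) + e"
    unfolding P_def Q_def by linarith
qed

section \<open>Powers of quadratic forms\<close>

text \<open>
  Young's inequality for \<open>s\<close> and \<open>m\<^bsup>r - 1\<^esup>\<close>, multiplied by \<open>r\<close>.
\<close>
lemma powr_above_tangent:
  fixes s m r :: real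
  assumes "r \<ge> 1" and m: "m > 0" and s: "s \<ge> 0"
  shows "m powr r + r * m powr (r - 1) * (s - m) \<le> s powr r"
proof -
  have mm: "m powr (r - 1) * m = m powr r"
    using m by (simp add: powr_diff)
  show ?thesis
  proof (cases "s = 0")
    case True
    have "m powr r \<le> r * m powr r" using assms(1) by (simp add: mult_le_cancel_right1)
    with True mm show ?thesis by (simp add: mult.assoc)
  next
    case False
    have "(s powr r) powr (1 / r) * (m powr r) powr (1 - 1 / r) \<le> 1 / r * s powr r + (1 - 1 / r) * m powr r"
      using assms False by (intro Youngs_inequality_0) simp_all
    moreover have "r * (1 - 1 / r) = r - 1" using assms(1) by (simp add: field_simps)
    ultimately have "s * m powr (r - 1) \<le> 1 / r * s powr r + (1 - 1 / r) * m powr r"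
      using assms by (simp add: powr_powr)
    then have "r * (s * m powr (r - 1)) \<le> r * (1 / r * s powr r + (1 - 1 / r) * m powr r)"
      using assms(1) by (intro mult_left_mono) simp_all
    also have "\<dots> = s powr r + (r - 1) * m powr r"
      using assms(1) by (simp add: field_simps)
    finally show ?thesis using mm by (simp add: algebra_simps)
  qed
qed

text \<open>
  Jensen's inequality for the probability measure \<open>h \<mapsto> \<langle>h(A) x, x\<rangle>\<close>: integrate the tangent of
  \<open>s \<mapsto> s\<^bsup>r\<^esup>\<close> at the mean \<open>m\<close>, using monotonicity of the calculus.
\<close>
lemma cfc_form_powr_le:
  assumes A: "positive_op A" and h: "continuous_on {0..} h"
    and nonneg: "\<And>t. t \<ge> 0 \<Longrightarrow> h t \<ge> 0" and r: "r \<ge> 1" and x: "norm x = 1"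
  shows "Re (cinner (blinfun_apply (cfc A h) x) x) powr r \<le>
    Re (cinner (blinfun_apply (cfc A (\<lambda>t. h t powr r)) x) x)"
proof -
  define m where "m = Re (cinner (blinfun_apply (cfc A h) x) x)"
  have hr: "continuous_on {0..} (\<lambda>t. h t powr r)"
    by (rule continuous_on_powr'[OF h]) (use nonneg r in auto)
  have "m \<ge> 0" unfolding m_def by (intro cfc_form_nonneg A h nonneg)
  then consider "m = 0" | "m > 0" by linarith
  then have "m powr r \<le> Re (cinner (blinfun_apply (cfc A (\<lambda>t. h t powr r)) x) x)"
  proof cases
    case 1
    then show ?thesis using cfc_form_nonneg[OF A hr] by simp
  next
    case 2
    define c where "c = r * m powr (r - 1)"
    define a where "a = m powr r - c * m"
    \<comment> \<open>The tangent at \<open>m\<close> is \<open>s \<mapsto> c s + a\<close>; the double minus makes it an instance of the rule for differences.\<close>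
    have cont: "continuous_on {0..} (\<lambda>t. c * h t)" by (intro continuous_intros h)
    have "Re (cinner (blinfun_apply (cfc A (\<lambda>t. c * h t - - a)) x) x) \<le>
        Re (cinner (blinfun_apply (cfc A (\<lambda>t. h t powr r)) x) x)"
    proof (rule cfc_form_mono[OF A _ hr])
      show "c * h t - - a \<le> h t powr r" if "t \<ge> 0" for t
        using powr_above_tangent[OF r 2 nonneg[OF that]] by (simp add: a_def c_def algebra_simps)
    qed (intro continuous_intros h)
    moreover have "Re (cinner (blinfun_apply (cfc A (\<lambda>t. c * h t - - a)) x) x) = c * m + a"
      by (simp only: cfc_diff[OF A cont continuous_on_const] cfc_const[OF A]
          cfc_mult[OF A continuous_on_const h])
        (simp add: blinfun.diff_left blinfun.scaleR_left blinfun.add_left blinfun.minus_left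
          cinner.add_left cinner.scaleR_left cinner.diff_left cinner.minus_left Re_cinner_self x m_def)
    ultimately show ?thesis by (simp add: a_def)
  qed
  then show ?thesis by (simp add: m_def)
qed

lemma norm_cfc_powr_le:
  assumes A: "positive_op A" and h: "continuous_on {0..} h"
    and nonneg: "\<And>t. t \<ge> 0 \<Longrightarrow> h t \<ge> 0" and r: "r \<ge> 1" and x: "norm x = 1"
  shows "norm (blinfun_apply (cfc A h) x) powr r \<le>
    sqrt (Re (cinner (blinfun_apply (cfc A (\<lambda>t. h t powr (2 * r))) x) x))"
proof (rule real_le_rsqrt)
  have hh: "continuous_on {0..} (\<lambda>t. h t * h t)" by (intro continuous_intros h)
  have hr: "continuous_on {0..} (\<lambda>t. (h t * h t) powr r)"
    by (rule continuous_on_powr'[OF hh]) (use nonneg r in auto)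
  have "(norm (blinfun_apply (cfc A h) x) powr r)\<^sup>2 = ((norm (blinfun_apply (cfc A h) x))\<^sup>2) powr r"
    by (simp add: powr_mult power2_eq_square)
  also have "\<dots> \<le> Re (cinner (blinfun_apply (cfc A (\<lambda>t. (h t * h t) powr r)) x) x)"
    unfolding norm_cfc_square[OF A h] by (intro cfc_form_powr_le A hh r x) simp
  also have "cfc A (\<lambda>t. (h t * h t) powr r) = cfc A (\<lambda>t. h t powr (2 * r))"
  proof (rule cfc_cong[OF A hr])
    show "(h t * h t) powr r = h t powr (2 * r)" if "t \<ge> 0" for t
      using nonneg[OF that] by (simp only: powr_mult mult_2 powr_add)
  qed
  finally show "(norm (blinfun_apply (cfc A h) x) powr r)\<^sup>2 \<le>
    Re (cinner (blinfun_apply (cfc A (\<lambda>t. h t powr (2 * r))) x) x)" .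
qed

section \<open>Numerical radius\<close>

text \<open>
  The power \<open>r\<close> is moved to the other side before the supremum is taken.
\<close>
lemma numerical_radius_powr_le:
  assumes r: "r > 0" and C: "C \<ge> 0"
    and bound: "\<And>x. norm x = 1 \<Longrightarrow> cmod (cinner (blinfun_apply X x) x) powr r \<le> C"
  shows "numerical_radius X powr r \<le> C"
proof -
  define S where "S = insert 0 {cmod (cinner (blinfun_apply X x) x) | x. norm x = 1}"
  have le: "s \<le> C powr (1 / r)" if "s \<in> S" for s
  proof (cases "s = 0")
    case False
    with that obtain x where x: "s = cmod (cinner (blinfun_apply X x) x)" "norm x = 1"
      by (auto simp: S_def)
    then have "(s powr r) powr (1 / r) \<le> C powr (1 / r)"
      using bound[OF x(2)] r by (intro powr_mono2) simp_all
    then show ?thesis using r x by (simp add: powr_powr)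
  qed simp
  have "0 \<in> S" by (simp add: S_def)
  then have "0 \<le> Sup S" using le by (intro cSup_upper bdd_aboveI) auto
  moreover have "Sup S \<le> C powr (1 / r)" using le \<open>0 \<in> S\<close> by (intro cSup_least) auto
  ultimately have "Sup S powr r \<le> (C powr (1 / r)) powr r" using r by (intro powr_mono2) simp_all
  then show ?thesis using r C by (simp add: numerical_radius_def S_def powr_powr)
qed

lemma Re_cinner_le_norm:
  assumes "norm x = 1"
  shows "Re (cinner (blinfun_apply A x) x) \<le> norm A"
  using complex_Re_le_cmod[of "cinner (blinfun_apply A x) x"]
    cinner_cauchy_schwarz[of "blinfun_apply A x" x] norm_blinfun[of A x] assms by simp

text \<open>
  The Cauchy--Schwarz inequality for the vectors \<open>(\<surd>a, \<surd>b)\<close> and \<open>(\<surd>d, \<surd>c)\<close>.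
\<close>
lemma sqrt_mult_add_sqrt_mult_le:
  fixes a b c d :: real
  assumes "a \<ge> 0" "b \<ge> 0" "c \<ge> 0" "d \<ge> 0"
  shows "sqrt a * sqrt d + sqrt b * sqrt c \<le> sqrt (a + b) * sqrt (c + d)"
  unfolding real_sqrt_mult[symmetric]
proof (rule real_le_rsqrt)
  have "2 * (sqrt (a * c) * sqrt (b * d)) \<le> a * c + b * d"
    using sum_squares_bound[of "sqrt (a * c)" "sqrt (b * d)"] assms by (simp add: mult.assoc)
  moreover have "sqrt (a * d) * sqrt (b * c) = sqrt (a * c) * sqrt (b * d)"
    by (simp add: real_sqrt_mult)
  ultimately show "(sqrt (a * d) + sqrt (b * c))\<^sup>2 \<le> (a + b) * (c + d)"
    using assms by (simp add: power2_sum algebra_simps)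
qed

theorem corollary2p7:
  fixes X :: "'a::chilbert_space \<Rightarrow>\<^sub>L 'a"
    and r :: real
    and f g :: "real \<Rightarrow> real"
  assumes "X \<in> bounded_ops"
    and "r \<ge> 1"
    and "continuous_on {0..} f"
    and "continuous_on {0..} g"
    and "\<And>t. t \<ge> 0 \<Longrightarrow> f t \<ge> 0"
    and "\<And>t. t \<ge> 0 \<Longrightarrow> g t \<ge> 0"
    and "\<And>t. t \<ge> 0 \<Longrightarrow> f t * g t = t"
  shows "numerical_radius X powr r \<le> 2 powr (r - 2) *
      norm (cfc (abs_op X) (\<lambda>t. f t powr (2 * r)) + cfc (abs_op (adj X)) (\<lambda>t. g t powr (2 * r)))
    \<and> numerical_radius X powr r \<le> 2 powr (r - 2) *
      norm (cfc (abs_op X) (\<lambda>t. f t powr (2 * r)) + cfc (abs_op (adj X)) (\<lambda>t. f t powr (2 * r)))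
        powr (1 / 2) *
      norm (cfc (abs_op X) (\<lambda>t. g t powr (2 * r)) + cfc (abs_op (adj X)) (\<lambda>t. g t powr (2 * r)))
        powr (1 / 2)"
proof -
  note X = assms(1) and aX = adj_bounded_ops[OF assms(1)]
  define F where "F Y h = cfc (abs_op Y) (\<lambda>t. h t powr (2 * r))" for Y :: "'a \<Rightarrow>\<^sub>L 'a" and h :: "real \<Rightarrow> real"
  define q where "q Y h x = Re (cinner (blinfun_apply (F Y h) x) x)" for Y h x
  have q_nonneg: "q Y h x \<ge> 0"
    if "Y \<in> bounded_ops" "continuous_on {0..} h" "\<And>t. t \<ge> 0 \<Longrightarrow> h t \<ge> 0" for Y h x
    unfolding q_def F_def
    by (intro cfc_form_nonneg positive_abs_op that continuous_on_powr' continuous_on_const)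
      (use that assms(2) in auto)
  have schwarz: "cmod (cinner (blinfun_apply Y x) x) powr r \<le> sqrt (q Y f x) * sqrt (q (adj Y) g x)"
    if Y: "Y \<in> bounded_ops" and x: "norm x = 1" for Y x
  proof -
    have "cmod (cinner (blinfun_apply Y x) x) powr r \<le>
        (norm (blinfun_apply (cfc (abs_op Y) f) x) * norm (blinfun_apply (cfc (abs_op (adj Y)) g) x)) powr r"
      using assms(2) by (intro powr_mono2 mixed_schwarz Y assms(3,4,7)) simp_all
    also have "\<dots> = norm (blinfun_apply (cfc (abs_op Y) f) x) powr r *
        norm (blinfun_apply (cfc (abs_op (adj Y)) g) x) powr r"
      by (simp add: powr_mult)
    also have "\<dots> \<le> sqrt (q Y f x) * sqrt (q (adj Y) g x)"
    proof (rule mult_mono)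
      show "norm (blinfun_apply (cfc (abs_op Y) f) x) powr r \<le> sqrt (q Y f x)"
        and "norm (blinfun_apply (cfc (abs_op (adj Y)) g) x) powr r \<le> sqrt (q (adj Y) g x)"
        unfolding q_def F_def
        by (rule norm_cfc_powr_le[OF _ assms(3,5,2) x] norm_cfc_powr_le[OF _ assms(4,6,2) x];
            simp add: positive_abs_op adj_bounded_ops Y)+
    qed (simp_all add: q_nonneg Y assms(3,5))
    finally show ?thesis .
  qed
  have q_add: "q Y h x + q Z k x \<le> norm (F Y h + F Z k)" if "norm x = 1" for Y Z h k x
    using Re_cinner_le_norm[OF that, of "F Y h + F Z k"]
    by (simp add: q_def blinfun.add_left cinner_add_left)
  have half: "1 / 2 * c \<le> 2 powr (r - 2) * c" if "c \<ge> 0" for c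
  proof (rule mult_right_mono[OF _ that])
    have "2 powr (- 1) \<le> (2::real) powr (r - 2)" using assms(2) by (intro powr_mono) simp_all
    then show "1 / 2 \<le> (2::real) powr (r - 2)" by (simp add: powr_minus)
  qed
  let ?N = "norm (F X f + F (adj X) g)"
  have "numerical_radius X powr r \<le> 1 / 2 * ?N"
  proof (rule numerical_radius_powr_le)
    fix x :: 'a assume x: "norm x = 1"
    have "2 * (sqrt (q X f x) * sqrt (q (adj X) g x)) \<le> q X f x + q (adj X) g x"
      using sum_squares_bound[of "sqrt (q X f x)" "sqrt (q (adj X) g x)"]
      by (simp add: q_nonneg X aX assms(3-6) mult.assoc)
    with schwarz[OF X x] q_add[OF x, of X f "adj X" g]
    show "cmod (cinner (blinfun_apply X x) x) powr r \<le> 1 / 2 * ?N" by linarith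
  qed (use assms(2) in simp_all)
  moreover have "numerical_radius X powr r \<le>
    1 / 2 * (sqrt (norm (F X f + F (adj X) f)) * sqrt (norm (F X g + F (adj X) g)))"
  proof (rule numerical_radius_powr_le)
    fix x :: 'a assume x: "norm x = 1"
    have "cmod (cinner (blinfun_apply (adj X) x) x) = cmod (cinner (blinfun_apply X x) x)"
      unfolding cinner_adj_left[OF X] by (subst cinner_commute) simp
    with schwarz[OF X x] schwarz[OF aX x]
    have "2 * cmod (cinner (blinfun_apply X x) x) powr r \<le>
        sqrt (q X f x) * sqrt (q (adj X) g x) + sqrt (q (adj X) f x) * sqrt (q X g x)"
      by (simp add: adj_adj[OF X])
    also have "\<dots> \<le> sqrt (q X f x + q (adj X) f x) * sqrt (q X g x + q (adj X) g x)"
      by (intro sqrt_mult_add_sqrt_mult_le q_nonneg X aX assms)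
    also have "\<dots> \<le> sqrt (norm (F X f + F (adj X) f)) * sqrt (norm (F X g + F (adj X) g))"
      by (intro mult_mono real_sqrt_le_mono q_add[OF x]) (simp_all add: q_nonneg X aX assms(3-6))
    finally show "cmod (cinner (blinfun_apply X x) x) powr r \<le>
        1 / 2 * (sqrt (norm (F X f + F (adj X) f)) * sqrt (norm (F X g + F (adj X) g)))"
      by linarith
  qed (use assms(2) in simp_all)
  ultimately show ?thesis
    using half[of ?N] half[of "sqrt (norm (F X f + F (adj X) f)) * sqrt (norm (F X g + F (adj X) g))"]
    by (simp add: F_def powr_half_sqrt mult.assoc)
qed

end
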